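(* Let $\lambda>0$ be a real number, let $\delta\in L^1_{\mathrm{loc}}((0,+\infty))$ be nonnegative, and consider the equation $$u''(t)+2\delta(t)u'(t)+\lambda^2u(t)=0.$$ (1) If $\delta\in L^1((0,+\infty))$, then no nonzero solution decays to zero, in the sense that $|u'(t)|^2+\lambda^2|u(t)|^2$ does not tend to $0$ as $t\to+\infty$. (2) If there exists a constant $M>0$ such that $\delta(t)\le M$ for every $t\ge 0$, then all solutions satisfy $$|u'(t)|^2+\lambda^2|u(t)|^2\ge\left(|u'(0)|^2+\lambda^2|u(0)|^2\right)e^{-4Mt}\qquad\forall t\ge 0.$$ (3) If there exists $T\ge 0$ such that $\delta(t)\ge\lambda$ for every $t\ge T$, then there exist $T_*\ge T$ and a solution $u(t)$ to the equation such that $$|u(t)|\ge te^{-\lambda t}\qquad\forall t\ge T_*.$$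
   Context: A solution is a real-valued function $u\in C^1((0,+\infty))$ with $u'$ locally absolutely continuous on $(0,+\infty)$ satisfying the equation for almost every $t>0$. If $\delta$ is integrable near $t=0$ (as in (1) and (2)), then $u$ and $u'$ extend continuously to $t=0$, and $u(0)$, $u'(0)$ denote the extended values. *)

theory Defs
  imports "HOL-Analysis.Analysis"
begin

definition loc_integrable_on :: "(real \<Rightarrow> real) \<Rightarrow> real set \<Rightarrow> bool"
    (infix \<open>loc'_integrable'_on\<close> 50) where
  "f loc_integrable_on S \<longleftrightarrow>
     (\<forall>K. compact K \<and> K \<subseteq> S \<longrightarrow> f absolutely_integrable_on K)"

definition abs_continuous_on :: "real set \<Rightarrow> (real \<Rightarrow> real) \<Rightarrow> bool" where
  "abs_continuous_on I f \<longleftrightarrow>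
     (\<forall>\<epsilon>>0. \<exists>\<eta>>0. \<forall>(n::nat) (x::nat \<Rightarrow> real) (y::nat \<Rightarrow> real).
        (\<forall>i<n. x i \<le> y i \<and> {x i..y i} \<subseteq> I) \<and>
        (\<forall>i<n. \<forall>j<n. i \<noteq> j \<longrightarrow> {x i<..<y i} \<inter> {x j<..<y j} = {}) \<and>
        (\<Sum>i<n. y i - x i) < \<eta> \<longrightarrow>
        (\<Sum>i<n. \<bar>f (y i) - f (x i)\<bar>) < \<epsilon>)"

definition loc_abs_continuous_on :: "real set \<Rightarrow> (real \<Rightarrow> real) \<Rightarrow> bool" where
  "loc_abs_continuous_on S f \<longleftrightarrow>
     (\<forall>a b. a \<le> b \<and> {a..b} \<subseteq> S \<longrightarrow> abs_continuous_on {a..b} f)"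

text \<open>Functions on \<open>(0, \<infinity>)\<close> are total functions on the reals; their values at
  \<open>t \<le> 0\<close> are irrelevant.\<close>

definition is_solution :: "real \<Rightarrow> (real \<Rightarrow> real) \<Rightarrow> (real \<Rightarrow> real) \<Rightarrow> bool" where
  "is_solution lam \<delta> u \<longleftrightarrow>
     (\<forall>t>0. u field_differentiable at t) \<and>
     continuous_on {0<..} (deriv u) \<and>
     loc_abs_continuous_on {0<..} (deriv u) \<and>
     (AE t in lebesgue. t > 0 \<longrightarrow>
        deriv u field_differentiable at t \<and>
        deriv (deriv u) t + 2 * \<delta> t * deriv u t + lam\<^sup>2 * u t = 0)"

text \<open>Extension of a function on \<open>(0, \<infinity>)\<close> to \<open>t = 0\<close> by its right-hand limit. This is the
  continuous extension only when the limit exists, i.e. when the result is continuous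
  on \<open>[0, \<infinity>)\<close>.\<close>

definition ext0 :: "(real \<Rightarrow> real) \<Rightarrow> real \<Rightarrow> real" where
  "ext0 f t = (if t = 0 then Lim (at_right 0) f else f t)"

end

theory Submission
  imports Defs
begin

text \<open>
  Along a solution the energy \<open>u'\<^sup>2 + lam\<^sup>2 u\<^sup>2\<close> has derivative \<open>-4 \<delta> u'\<^sup>2\<close>, which is at least
  \<open>-4 \<delta>\<close> times the energy; integrating, the energy decays at most by the factor \<open>exp (-4 \<integral>\<delta>)\<close>.
  This gives (1) and (2). In (2) it also bounds \<open>u\<close> and \<open>u'\<close> near \<open>0\<close>, so that both are Lipschitz
  there and extend continuously.

  For (3), take the solution that starts at some \<open>c \<ge> T\<close> with \<open>u c > 0\<close> and \<open>u' c = 0\<close>. Where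
  \<open>u \<ge> 0\<close> it is decreasing, and \<open>z = exp (lam t) u\<close> satisfies
  \<open>z'' = 2 exp (lam t) (lam - \<delta>) u' \<ge> 0\<close>. Hence \<open>z\<close> stays above an increasing affine function.
\<close>

section \<open>Absolutely continuous functions\<close>

text \<open>Since \<open>\<delta>\<close> is only locally integrable, \<open>u'\<close> is merely
  absolutely continuous and the equation holds almost everywhere. A sign condition on an almost
  everywhere derivative controls a function only if the function is the integral of that derivative.
  So every quantity containing \<open>u'\<close> (the logarithm of the shifted energy,
  \<open>z'\<close>, and \<open>u'\<close> itself near 0) is first shown to be absolutely continuous
  and then integrated; the fundamental theorem for such functions carries all three parts. Estimates
  are made on compact intervals inside the open half-line; in (2) the left endpoint is afterwards
  sent to 0. In (3) the solution itself has to be constructed, although the coefficient is not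
  continuous. An integrating factor turns the equation into a linear system with continuous
  coefficients, to which Picard iteration applies; the same factor shows that \<open>u\<close>
  decreases while it is nonnegative. The rescaling by \<open>exp (lam t)\<close> is that of critical
  damping: for \<open>\<delta> = lam\<close> it gives \<open>z'' = 0\<close>, so \<open>z\<close> is
  affine, and stronger damping only bends it upwards. A large enough value \<open>u c\<close> lifts
  the affine bound above \<open>t\<close>.\<close>

lemma continuous_on_interval_bounded:
  fixes f :: "real \<Rightarrow> real"
  assumes "continuous_on {a..b} f"
  obtains B where "\<And>x. x \<in> {a..b} \<Longrightarrow> \<bar>f x\<bar> \<le> B"
proof -
  have "bounded (f ` {a..b})"
    using assms compact_continuous_image compact_imp_bounded by blast
  then show thesis
    using that unfolding bounded_iff by (auto simp del: atLeastAtMost_iff)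
qed

text \<open>Additivity and monotonicity of Lebesgue measure. Open intervals are used because
  neighbouring pieces of a division share endpoints.\<close>

lemma sum_interval_lengths_le_measure:
  fixes x y :: "'i \<Rightarrow> real"
  assumes "finite I" "U \<in> lmeasurable"
    and "\<And>i. i \<in> I \<Longrightarrow> x i \<le> y i" "\<And>i. i \<in> I \<Longrightarrow> {x i<..<y i} \<subseteq> U"
    and disj: "disjoint_family_on (\<lambda>i. {x i<..<y i}) I"
  shows "(\<Sum>i\<in>I. y i - x i) \<le> measure lebesgue U"
proof -
  have "(\<Sum>i\<in>I. y i - x i) = (\<Sum>i\<in>I. measure lebesgue {x i<..<y i})"
    using assms(3) by (intro sum.cong) auto
  also have "\<dots> = measure lebesgue (\<Union>i\<in>I. {x i<..<y i})"
    by (rule measure_finite_Union[symmetric]) (use assms in \<open>auto simp: emeasure_lborel_Ioo\<close>)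
  also have "\<dots> \<le> measure lebesgue U"
    using assms by (intro measure_mono_fmeasurable) auto
  finally show ?thesis .
qed

text \<open>A bijection with an initial segment of the naturals carries the definition over to any
  finite index type. The intervals of a tagged division are naturally indexed by pairs of a tag and
  a set.\<close>

lemma abs_continuous_onE:
  fixes f :: "real \<Rightarrow> real"
  assumes "abs_continuous_on S f" "\<epsilon> > 0"
  obtains \<eta> where "\<eta> > 0"
    "\<forall>(I :: 'i set) x y. finite I \<and> (\<forall>i\<in>I. x i \<le> y i \<and> {x i..y i} \<subseteq> S) \<and>
       disjoint_family_on (\<lambda>i. {x i<..<y i}) I \<and> (\<Sum>i\<in>I. y i - x i) < \<eta>
       \<longrightarrow> (\<Sum>i\<in>I. \<bar>f (y i) - f (x i)\<bar>) < \<epsilon>"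
proof -
  obtain \<eta> where "\<eta> > 0" and \<eta>: "\<forall>(n::nat) (x::nat \<Rightarrow> real) (y::nat \<Rightarrow> real).
        (\<forall>i<n. x i \<le> y i \<and> {x i..y i} \<subseteq> S) \<and>
        (\<forall>i<n. \<forall>j<n. i \<noteq> j \<longrightarrow> {x i<..<y i} \<inter> {x j<..<y j} = {}) \<and>
        (\<Sum>i<n. y i - x i) < \<eta> \<longrightarrow> (\<Sum>i<n. \<bar>f (y i) - f (x i)\<bar>) < \<epsilon>"
    using assms(1)[unfolded abs_continuous_on_def, THEN spec, THEN mp, OF assms(2)] by (elim exE conjE)
  show thesis
  proof (rule that[OF \<open>\<eta> > 0\<close>])
    have "(\<Sum>i\<in>I. \<bar>f (y i) - f (x i)\<bar>) < \<epsilon>"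
      if I: "finite I" "\<And>i. i \<in> I \<Longrightarrow> x i \<le> y i" "\<And>i. i \<in> I \<Longrightarrow> {x i..y i} \<subseteq> S"
        "disjoint_family_on (\<lambda>i. {x i<..<y i}) I" "(\<Sum>i\<in>I. y i - x i) < \<eta>"
      for I :: "'i set" and x y :: "'i \<Rightarrow> real"
    proof -
      obtain h where h: "bij_betw h {..<card I} I"
        using ex_bij_betw_nat_finite[OF \<open>finite I\<close>] by (auto simp: atLeast0LessThan)
      have hI: "h i \<in> I" if "i < card I" for i
        using h that by (auto simp: bij_betw_def)
      have hinj: "h i \<noteq> h j" if "i < card I" "j < card I" "i \<noteq> j" for i j
        using h that by (auto simp: bij_betw_def inj_on_def)
      have "(\<Sum>i<card I. \<bar>f (y (h i)) - f (x (h i))\<bar>) < \<epsilon>"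
      proof (rule \<eta>[rule_format], intro conjI)
        show "(\<Sum>i<card I. y (h i) - x (h i)) < \<eta>"
          using I(5) sum.reindex_bij_betw[OF h, of "\<lambda>i. y i - x i"] by simp
        show "\<forall>i<card I. \<forall>j<card I. i \<noteq> j \<longrightarrow> {x (h i)<..<y (h i)} \<inter> {x (h j)<..<y (h j)} = {}"
          using I(4) hI hinj unfolding disjoint_family_on_def by blast
      qed (use I(2,3) hI in simp)
      then show ?thesis
        using sum.reindex_bij_betw[OF h, of "\<lambda>i. \<bar>f (y i) - f (x i)\<bar>"] by simp
    qed
    then show "\<forall>(I :: 'i set) x y. finite I \<and> (\<forall>i\<in>I. x i \<le> y i \<and> {x i..y i} \<subseteq> S) \<and>
       disjoint_family_on (\<lambda>i. {x i<..<y i}) I \<and> (\<Sum>i\<in>I. y i - x i) < \<eta>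
       \<longrightarrow> (\<Sum>i\<in>I. \<bar>f (y i) - f (x i)\<bar>) < \<epsilon>"
      by simp
  qed
qed

text \<open>Absolute continuity sees only increments, so a linear bound on increments transfers it.
  Sums, products, Lipschitz images and functions equal on \<open>S\<close> are all
  instances.\<close>

lemma abs_continuous_on_dominated:
  assumes f: "abs_continuous_on S f" and g: "abs_continuous_on S g"
    and le: "\<And>x y. \<lbrakk>x \<le> y; {x..y} \<subseteq> S\<rbrakk> \<Longrightarrow> \<bar>h y - h x\<bar> \<le> A * \<bar>f y - f x\<bar> + B * \<bar>g y - g x\<bar>"
  shows "abs_continuous_on S h"
  unfolding abs_continuous_on_def
proof (intro allI impI)
  fix \<epsilon> :: real assume "\<epsilon> > 0"
  \<comment> \<open>A single positive constant above both coefficients, whatever their signs; it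
    makes the division by \<open>2 * C\<close> legitimate.\<close>
  define C where "C = \<bar>A\<bar> + \<bar>B\<bar> + 1"
  have C: "C > 0" "A \<le> C" "B \<le> C" by (auto simp: C_def)
  then have e: "\<epsilon> / (2 * C) > 0" using \<open>\<epsilon> > 0\<close> by simp
  obtain \<eta>1 where 1: "\<eta>1 > 0" "\<forall>(I :: nat set) x y. finite I \<and> (\<forall>i\<in>I. x i \<le> y i \<and> {x i..y i} \<subseteq> S) \<and>
       disjoint_family_on (\<lambda>i. {x i<..<y i}) I \<and> (\<Sum>i\<in>I. y i - x i) < \<eta>1
       \<longrightarrow> (\<Sum>i\<in>I. \<bar>f (y i) - f (x i)\<bar>) < \<epsilon> / (2 * C)"
    using abs_continuous_onE[OF f e, where 'i = nat] .
  obtain \<eta>2 where 2: "\<eta>2 > 0" "\<forall>(I :: nat set) x y. finite I \<and> (\<forall>i\<in>I. x i \<le> y i \<and> {x i..y i} \<subseteq> S) \<and>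
       disjoint_family_on (\<lambda>i. {x i<..<y i}) I \<and> (\<Sum>i\<in>I. y i - x i) < \<eta>2
       \<longrightarrow> (\<Sum>i\<in>I. \<bar>g (y i) - g (x i)\<bar>) < \<epsilon> / (2 * C)"
    using abs_continuous_onE[OF g e, where 'i = nat] .
  have "(\<Sum>i<n. \<bar>h (y i) - h (x i)\<bar>) < \<epsilon>"
    if *: "\<forall>i<n. x i \<le> y i \<and> {x i..y i} \<subseteq> S"
        "\<forall>i<n. \<forall>j<n. i \<noteq> j \<longrightarrow> {x i<..<y i} \<inter> {x j<..<y j} = {}"
        "(\<Sum>i<n. y i - x i) < min \<eta>1 \<eta>2" for n :: nat and x y :: "nat \<Rightarrow> real"
  proof -
    have "(\<Sum>i<n. \<bar>h (y i) - h (x i)\<bar>)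
        \<le> (\<Sum>i<n. C * \<bar>f (y i) - f (x i)\<bar> + C * \<bar>g (y i) - g (x i)\<bar>)"
    proof (rule sum_mono)
      fix i assume "i \<in> {..<n}"
      then have "\<bar>h (y i) - h (x i)\<bar> \<le> A * \<bar>f (y i) - f (x i)\<bar> + B * \<bar>g (y i) - g (x i)\<bar>"
        using * by (intro le) auto
      also have "\<dots> \<le> C * \<bar>f (y i) - f (x i)\<bar> + C * \<bar>g (y i) - g (x i)\<bar>"
        using C by (intro add_mono mult_right_mono) auto
      finally show "\<bar>h (y i) - h (x i)\<bar> \<le> C * \<bar>f (y i) - f (x i)\<bar> + C * \<bar>g (y i) - g (x i)\<bar>" .
    qed
    also have "\<dots> = C * (\<Sum>i<n. \<bar>f (y i) - f (x i)\<bar>) + C * (\<Sum>i<n. \<bar>g (y i) - g (x i)\<bar>)"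
      by (simp add: sum.distrib sum_distrib_left)
    also have "\<dots> < C * (\<epsilon> / (2 * C)) + C * (\<epsilon> / (2 * C))"
      using C *
      by (intro add_strict_mono mult_strict_left_mono 1(2)[rule_format] 2(2)[rule_format]) (auto simp: disjoint_family_on_def)
    also have "\<dots> = \<epsilon>" using C by simp
    finally show ?thesis .
  qed
  then show "\<exists>\<eta>>0. \<forall>(n::nat) (x::nat \<Rightarrow> real) (y::nat \<Rightarrow> real).
        (\<forall>i<n. x i \<le> y i \<and> {x i..y i} \<subseteq> S) \<and>
        (\<forall>i<n. \<forall>j<n. i \<noteq> j \<longrightarrow> {x i<..<y i} \<inter> {x j<..<y j} = {}) \<and>
        (\<Sum>i<n. y i - x i) < \<eta> \<longrightarrow> (\<Sum>i<n. \<bar>h (y i) - h (x i)\<bar>) < \<epsilon>"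
    using \<open>\<eta>1 > 0\<close> \<open>\<eta>2 > 0\<close> by (intro exI[of _ "min \<eta>1 \<eta>2"]) auto
qed

lemma abs_continuous_on_ident: "abs_continuous_on S (\<lambda>x. x)"
  unfolding abs_continuous_on_def
proof (intro allI impI)
  fix \<epsilon> :: real assume "\<epsilon> > 0"
  have "(\<Sum>i<n. \<bar>y i - x i\<bar>) = (\<Sum>i<n. y i - x i)" if "\<forall>i<n. x i \<le> y i"
    for n and x y :: "nat \<Rightarrow> real" using that by (intro sum.cong) auto
  with \<open>\<epsilon> > 0\<close> show "\<exists>\<eta>>0. \<forall>(n::nat) (x::nat \<Rightarrow> real) (y::nat \<Rightarrow> real).
        (\<forall>i<n. x i \<le> y i \<and> {x i..y i} \<subseteq> S) \<and>
        (\<forall>i<n. \<forall>j<n. i \<noteq> j \<longrightarrow> {x i<..<y i} \<inter> {x j<..<y j} = {}) \<and>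
        (\<Sum>i<n. y i - x i) < \<eta> \<longrightarrow> (\<Sum>i<n. \<bar>y i - x i\<bar>) < \<epsilon>"
    by (intro exI[of _ \<epsilon>]) auto
qed

text \<open>The Lipschitz condition is imposed only at values of \<open>f\<close> on
  \<open>S\<close>, so that \<open>ln\<close> and \<open>exp\<close>, which are not globally
  Lipschitz, can be used as \<open>h\<close>.\<close>

lemma abs_continuous_on_lipschitz_compose:
  assumes f: "abs_continuous_on S f"
    and le: "\<And>x y. \<lbrakk>x \<in> S; y \<in> S\<rbrakk> \<Longrightarrow> \<bar>h (f y) - h (f x)\<bar> \<le> L * \<bar>f y - f x\<bar>"
  shows "abs_continuous_on S (\<lambda>x. h (f x))"
proof (rule abs_continuous_on_dominated[OF f f, of _ L 0])
  fix x y :: real assume "x \<le> y" "{x..y} \<subseteq> S"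
  then show "\<bar>h (f y) - h (f x)\<bar> \<le> L * \<bar>f y - f x\<bar> + 0 * \<bar>f y - f x\<bar>"
    using le[of x y] by (simp add: subset_iff)
qed

lemma abs_continuous_on_add:
  assumes "abs_continuous_on S f" "abs_continuous_on S g"
  shows "abs_continuous_on S (\<lambda>x. f x + g x)"
  by (rule abs_continuous_on_dominated[OF assms, of _ 1 1]) auto

lemma abs_continuous_on_mult:
  assumes f: "abs_continuous_on S f" "\<And>x. x \<in> S \<Longrightarrow> \<bar>f x\<bar> \<le> A"
    and g: "abs_continuous_on S g" "\<And>x. x \<in> S \<Longrightarrow> \<bar>g x\<bar> \<le> B"
  shows "abs_continuous_on S (\<lambda>x. f x * g x)"
proof (rule abs_continuous_on_dominated[OF f(1) g(1), of _ B A])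
  fix x y :: real assume "x \<le> y" "{x..y} \<subseteq> S"
  then have S: "x \<in> S" "y \<in> S" by auto
  have "f y * g y - f x * g x = (f y - f x) * g y + f x * (g y - g x)"
    by (simp add: algebra_simps)
  also have "\<bar>\<dots>\<bar> \<le> \<bar>f y - f x\<bar> * \<bar>g y\<bar> + \<bar>f x\<bar> * \<bar>g y - g x\<bar>"
    by (metis abs_mult abs_triangle_ineq)
  also have "\<dots> \<le> \<bar>f y - f x\<bar> * B + A * \<bar>g y - g x\<bar>"
    using S f(2) g(2) by (intro add_mono mult_left_mono mult_right_mono) auto
  finally show "\<bar>f y * g y - f x * g x\<bar> \<le> B * \<bar>f y - f x\<bar> + A * \<bar>g y - g x\<bar>"
    by (simp add: mult.commute)
qed

lemma abs_continuous_on_continuous_deriv: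
  fixes a b :: real
  assumes "\<And>x. x \<in> {a..b} \<Longrightarrow> (f has_real_derivative f' x) (at x)" "continuous_on {a..b} f'"
  shows "abs_continuous_on {a..b} f"
proof -
  obtain L where L: "\<And>x. x \<in> {a..b} \<Longrightarrow> \<bar>f' x\<bar> \<le> L"
    using continuous_on_interval_bounded[OF assms(2)] by blast
  have "\<bar>f y - f x\<bar> \<le> L * \<bar>y - x\<bar>" if "x \<in> {a..b}" "y \<in> {a..b}" for x y
    using field_differentiable_bound[of "{a..b}" f f' L y x] assms(1) L that
    by (auto intro: has_field_derivative_at_within)
  then show ?thesis
    by (intro abs_continuous_on_lipschitz_compose[OF abs_continuous_on_ident])
qed

lemma abs_continuous_on_imp_continuous_on:
  assumes "abs_continuous_on {a..b} f"
  shows "continuous_on {a..b} f"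
  unfolding continuous_on_iff
proof (intro ballI allI impI)
  fix x \<epsilon> :: real assume x: "x \<in> {a..b}" and "\<epsilon> > 0"
  obtain \<eta> where "\<eta> > 0" and \<eta>: "\<forall>(I :: nat set) x y. finite I \<and> (\<forall>i\<in>I. x i \<le> y i \<and> {x i..y i} \<subseteq> {a..b}) \<and>
       disjoint_family_on (\<lambda>i. {x i<..<y i}) I \<and> (\<Sum>i\<in>I. y i - x i) < \<eta>
       \<longrightarrow> (\<Sum>i\<in>I. \<bar>f (y i) - f (x i)\<bar>) < \<epsilon>"
    using abs_continuous_onE[OF assms \<open>\<epsilon> > 0\<close>, where 'i = nat] .
  have "dist (f y) (f x) < \<epsilon>" if "y \<in> {a..b}" "dist y x < \<eta>" for y
  proof (cases "x \<le> y")
    case True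
    then show ?thesis
      using \<eta>[rule_format, of "{0}" "\<lambda>_. x" "\<lambda>_. y"] x that by (auto simp: dist_real_def disjoint_family_on_def)
  next
    case False
    then show ?thesis
      using \<eta>[rule_format, of "{0}" "\<lambda>_. y" "\<lambda>_. x"] x that by (auto simp: dist_real_def disjoint_family_on_def)
  qed
  then show "\<exists>d>0. \<forall>x'\<in>{a..b}. dist x' x < d \<longrightarrow> dist (f x') (f x) < \<epsilon>"
    using \<open>\<eta> > 0\<close> by blast
qed

text \<open>Tags outside the exceptional set are controlled by the derivative; tags inside it lie in an
  open set of small measure, where absolute continuity applies.\<close>

theorem fundamental_theorem_of_calculus_abs_continuous:
  fixes f f' :: "real \<Rightarrow> real"
  assumes "a \<le> b" and ac: "abs_continuous_on {a..b} f" and N: "negligible N"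
    and der: "\<And>x. x \<in> {a..b} - N \<Longrightarrow> (f has_real_derivative f' x) (at x within {a..b})"
  shows "(f' has_integral (f b - f a)) {a..b}"
proof -
  \<comment> \<open>With the value 0 on \<open>N\<close>, a tag in \<open>N\<close> contributes
    nothing to the Riemann sum, and only the increment of \<open>f\<close> over its interval remains
    to be estimated.\<close>
  define g where "g x = (if x \<in> N then 0 else f' x)" for x
  have "(g has_integral (f b - f a)) (cbox a b)"
    unfolding has_integral
  proof (intro allI impI)
    fix \<epsilon> :: real assume "\<epsilon> > 0"
    \<comment> \<open>Half of the tolerance is spent on tags outside \<open>N\<close>, spread over
      total length \<open>b - a\<close>; the \<open>+ 1\<close> keeps the denominator positive when
      \<open>a = b\<close>.\<close>
    define e where "e = \<epsilon> / (2 * (b - a + 1))"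
    have "e > 0" using \<open>\<epsilon> > 0\<close> \<open>a \<le> b\<close> by (simp add: e_def)
    obtain \<eta> where "\<eta> > 0" and \<eta>: "\<forall>(I :: (real \<times> real set) set) x y. finite I \<and> (\<forall>i\<in>I. x i \<le> y i \<and> {x i..y i} \<subseteq> {a..b}) \<and>
       disjoint_family_on (\<lambda>i. {x i<..<y i}) I \<and> (\<Sum>i\<in>I. y i - x i) < \<eta>
       \<longrightarrow> (\<Sum>i\<in>I. \<bar>f (y i) - f (x i)\<bar>) < \<epsilon> / 2"
      using abs_continuous_onE[OF ac half_gt_zero[OF \<open>\<epsilon> > 0\<close>], where 'i = "real \<times> real set"] .
    have null: "N \<in> null_sets lebesgue"
      using N negligible_iff_null_sets by auto
    \<comment> \<open>Outer regularity: the null set is covered by an open set whose measure is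
      below the threshold of absolute continuity.\<close>
    then obtain U where U: "open U" "N \<subseteq> U" "U - N \<in> lmeasurable" "emeasure lebesgue (U - N) < \<eta>"
      using sets_lebesgue_outer_open[of N \<eta>] \<open>\<eta> > 0\<close> by auto
    have "U = (U - N) \<union> N" using \<open>N \<subseteq> U\<close> by auto
    then have UL: "U \<in> lmeasurable"
      using U(3) null by (metis fmeasurable.Un fmeasurableI_null_sets)
    have "measure lebesgue U = measure lebesgue (U - N)"
      using null UL by (simp add: measure_Diff_null_set)
    then have Uless: "measure lebesgue U < \<eta>"
      using U(3,4) \<open>\<eta> > 0\<close> by (simp add: emeasure_eq_measure2 ennreal_less_iff)
    \<comment> \<open>The gauge radius has two roles: at points of \<open>N\<close> it keeps the
      interval inside \<open>U\<close>, elsewhere it makes the linear approximation of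
      \<open>f\<close> accurate to \<open>e\<close>.\<close>
    have "\<exists>d>0. x \<in> {a..b} \<longrightarrow> (if x \<in> N then ball x d \<subseteq> U else
         (\<forall>y\<in>{a..b}. \<bar>y - x\<bar> < d \<longrightarrow> \<bar>f y - f x - (y - x) * f' x\<bar> \<le> e * \<bar>y - x\<bar>))" for x
    proof (cases "x \<in> N")
      case True
      then obtain d where "d > 0" "ball x d \<subseteq> U"
        using U(1,2) open_contains_ball by blast
      with True show ?thesis by auto
    next
      case False
      show ?thesis
      proof (cases "x \<in> {a..b}")
        case True
        then have "(f has_derivative (*) (f' x)) (at x within {a..b})"
          using der[of x] False by (simp add: has_field_derivative_def)
        then obtain d where "d > 0"
          "\<forall>y\<in>{a..b}. \<bar>y - x\<bar> < d \<longrightarrow> \<bar>f y - f x - f' x * (y - x)\<bar> \<le> e * \<bar>y - x\<bar>"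
          using \<open>e > 0\<close> unfolding has_derivative_within_alt real_norm_def by blast
        then show ?thesis
          using False by (intro exI[of _ d]) (auto simp: mult.commute)
      qed (auto intro: zero_less_one)
    qed
    then obtain d where d: "\<And>x. d x > 0" "\<And>x. x \<in> {a..b} \<Longrightarrow> x \<in> N \<Longrightarrow> ball x (d x) \<subseteq> U"
       "\<And>x y. \<lbrakk>x \<in> {a..b}; x \<notin> N; y \<in> {a..b}; \<bar>y - x\<bar> < d x\<rbrakk>
         \<Longrightarrow> \<bar>f y - f x - (y - x) * f' x\<bar> \<le> e * \<bar>y - x\<bar>"
      by metis
    show "\<exists>\<gamma>. gauge \<gamma> \<and> (\<forall>p. p tagged_division_of cbox a b \<and> \<gamma> fine p \<longrightarrow>
              norm ((\<Sum>(x,k)\<in>p. measure lborel k *\<^sub>R g x) - (f b - f a)) < \<epsilon>)"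
    proof (intro exI[of _ "\<lambda>x. ball x (d x)"] conjI allI impI; (elim conjE)?)
      show "gauge (\<lambda>x. ball x (d x))"
        using d(1) gauge_ball_dependent by blast
      fix p assume p: "p tagged_division_of cbox a b" and fine: "(\<lambda>x. ball x (d x)) fine p"
      \<comment> \<open>\<open>Inf K\<close> and \<open>Sup K\<close> serve as names for the
        endpoints of a division interval, as functions of the set itself.\<close>
      have pK: "x \<in> K \<and> K \<subseteq> {a..b} \<and> K \<subseteq> ball x (d x) \<and> Inf K \<le> Sup K \<and> K = {Inf K..Sup K}"
        if xK: "(x, K) \<in> p" for x K
      proof -
        obtain u v where "K = {u..v}" using tagged_division_ofD(4)[OF p xK] by auto
        moreover have "x \<in> K" "K \<subseteq> {a..b}" using tagged_division_ofD(2,3)[OF p xK] by auto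
        moreover have "K \<subseteq> ball x (d x)" using fine xK by (auto simp: fine_def)
        ultimately show ?thesis by auto
      qed
      have "finite p" using p by auto
      define q where "q = {z \<in> p. fst z \<in> N}"
      have "finite q" "q \<subseteq> p" using \<open>finite p\<close> by (auto simp: q_def)
      have disj: "disjoint_family_on (\<lambda>z. {Inf (snd z)<..<Sup (snd z)}) p"
        unfolding disjoint_family_on_def
      proof (intro ballI impI)
        fix z z' assume z: "z \<in> p" "z' \<in> p" "z \<noteq> z'"
        obtain x K x' K' where [simp]: "z = (x, K)" "z' = (x', K')" by (metis surj_pair)
        have "interior K \<inter> interior K' = {}"
          using tagged_division_ofD(5)[OF p, of x K x' K'] z by auto
        then show "{Inf (snd z)<..<Sup (snd z)} \<inter> {Inf (snd z')<..<Sup (snd z')} = {}"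
          using pK[of x K] pK[of x' K'] z
          by (metis \<open>z = (x, K)\<close> \<open>z' = (x', K')\<close> interior_atLeastAtMost_real snd_conv)
      qed
      then have disjq: "disjoint_family_on (\<lambda>z. {Inf (snd z)<..<Sup (snd z)}) q"
        using \<open>q \<subseteq> p\<close> disjoint_family_on_mono by blast
      have qle: "Inf (snd z) \<le> Sup (snd z)" "{Inf (snd z)..Sup (snd z)} \<subseteq> {a..b}"
        "{Inf (snd z)..Sup (snd z)} \<subseteq> U" if "z \<in> q" for z
      proof -
        obtain x K where [simp]: "z = (x, K)" by (metis surj_pair)
        have z: "(x, K) \<in> p" "x \<in> N" using that by (auto simp: q_def)
        show "Inf (snd z) \<le> Sup (snd z)" "{Inf (snd z)..Sup (snd z)} \<subseteq> {a..b}"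
          using pK[OF z(1)] by auto
        have "K \<subseteq> U" using pK[OF z(1)] d(2)[of x] z(2) by blast
        then show "{Inf (snd z)..Sup (snd z)} \<subseteq> U"
          using pK[OF z(1)] by auto
      qed
      have "(\<Sum>z\<in>q. Sup (snd z) - Inf (snd z)) \<le> measure lebesgue U"
        by (rule sum_interval_lengths_le_measure[OF \<open>finite q\<close> UL _ _ disjq])
           (use qle in \<open>force+\<close>)
      then have "(\<Sum>z\<in>q. \<bar>f (Sup (snd z)) - f (Inf (snd z))\<bar>) < \<epsilon> / 2"
        using \<open>finite q\<close> qle disjq Uless by (intro \<eta>[rule_format]) auto
      moreover have "(\<Sum>z\<in>q. \<bar>measure lborel (snd z) * g (fst z) - (f (Sup (snd z)) - f (Inf (snd z)))\<bar>)
          = (\<Sum>z\<in>q. \<bar>f (Sup (snd z)) - f (Inf (snd z))\<bar>)"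
        by (intro sum.cong) (auto simp: q_def g_def)
      ultimately have 1: "(\<Sum>z\<in>q. \<bar>measure lborel (snd z) * g (fst z) - (f (Sup (snd z)) - f (Inf (snd z)))\<bar>) < \<epsilon> / 2"
        by simp
      have "(\<Sum>z\<in>p - q. \<bar>measure lborel (snd z) * g (fst z) - (f (Sup (snd z)) - f (Inf (snd z)))\<bar>)
          \<le> (\<Sum>z\<in>p - q. e * (Sup (snd z) - Inf (snd z)))"
      proof (rule sum_mono)
        fix z assume z: "z \<in> p - q"
        obtain x K where [simp]: "z = (x, K)" by (metis surj_pair)
        have xK: "(x, K) \<in> p" "x \<notin> N" using z by (auto simp: q_def)
        define u v where "u = Inf K" and "v = Sup K"
        have K: "K = {u..v}" "u \<le> x" "x \<le> v" "a \<le> u" "v \<le> b" "K \<subseteq> ball x (d x)"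
          using pK[OF xK(1)] unfolding u_def[symmetric] v_def[symmetric] by auto
        have "u \<in> K" "v \<in> K" using K by auto
        then have "u \<in> ball x (d x)" "v \<in> ball x (d x)" using K(6) by blast+
        then have "\<bar>f u - f x - (u - x) * f' x\<bar> \<le> e * \<bar>u - x\<bar>" "\<bar>f v - f x - (v - x) * f' x\<bar> \<le> e * \<bar>v - x\<bar>"
          using K(2-5) xK(2) d(3)[of x u] d(3)[of x v] by (auto simp: dist_real_def)
        moreover have "(v - u) * f' x - (f v - f u) =
            (f u - f x - (u - x) * f' x) - (f v - f x - (v - x) * f' x)"
          by (simp add: algebra_simps)
        \<comment> \<open>The straddle argument: the tag lies between the endpoints, so the
          distances to it add up to exactly \<open>v - u\<close>.\<close>
        ultimately have "\<bar>(v - u) * f' x - (f v - f u)\<bar> \<le> e * \<bar>u - x\<bar> + e * \<bar>v - x\<bar>"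
          by linarith
        also have "\<dots> = e * (v - u)" using K by (simp add: algebra_simps)
        finally have *: "\<bar>(v - u) * f' x - (f v - f u)\<bar> \<le> e * (v - u)" .
        have "measure lborel K = v - u" using K by auto
        then show "\<bar>measure lborel (snd z) * g (fst z) - (f (Sup (snd z)) - f (Inf (snd z)))\<bar>
            \<le> e * (Sup (snd z) - Inf (snd z))"
          using * xK by (simp add: u_def v_def g_def)
      qed
      also have "\<dots> \<le> (\<Sum>z\<in>p. e * (Sup (snd z) - Inf (snd z)))"
        using pK \<open>e > 0\<close> \<open>finite p\<close> by (intro sum_mono2) (auto intro!: mult_nonneg_nonneg)
      also have "\<dots> = e * (b - a)"
        using additive_tagged_division_1[of a b p "\<lambda>x. x"] p \<open>a \<le> b\<close>
        by (simp add: sum_distrib_left[symmetric] case_prod_unfold)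
      also have "\<dots> < e * (b - a + 1)"
        using \<open>e > 0\<close> by simp
      also have "\<dots> = \<epsilon> / 2" using \<open>a \<le> b\<close> by (simp add: e_def divide_simps)
      finally have 2: "(\<Sum>z\<in>p - q. \<bar>measure lborel (snd z) * g (fst z) - (f (Sup (snd z)) - f (Inf (snd z)))\<bar>) < \<epsilon> / 2" .
      have "(\<Sum>(x,k)\<in>p. measure lborel k *\<^sub>R g x) - (f b - f a)
          = (\<Sum>z\<in>p. measure lborel (snd z) * g (fst z) - (f (Sup (snd z)) - f (Inf (snd z))))"
        using additive_tagged_division_1[of a b p f] p \<open>a \<le> b\<close>
        by (simp add: sum_subtractf case_prod_unfold)
      also have "norm \<dots> \<le> (\<Sum>z\<in>p. \<bar>measure lborel (snd z) * g (fst z) - (f (Sup (snd z)) - f (Inf (snd z)))\<bar>)"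
        using sum_abs by simp
      also have "\<dots> = (\<Sum>z\<in>p - q. \<bar>measure lborel (snd z) * g (fst z) - (f (Sup (snd z)) - f (Inf (snd z)))\<bar>)
          + (\<Sum>z\<in>q. \<bar>measure lborel (snd z) * g (fst z) - (f (Sup (snd z)) - f (Inf (snd z)))\<bar>)"
        using \<open>finite p\<close> \<open>q \<subseteq> p\<close> by (metis (no_types, lifting) sum.subset_diff)
      also have "\<dots> < \<epsilon>" using 1 2 by simp
      finally show "norm ((\<Sum>(x,k)\<in>p. measure lborel k *\<^sub>R g x) - (f b - f a)) < \<epsilon>" .
    qed
  qed
  then show ?thesis
    using has_integral_spike[OF N, of "{a..b}" f' g] by (auto simp: g_def)
qed

text \<open>The fundamental theorem supplies integrability of \<open>f'\<close>. Replacing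
  \<open>g\<close> by \<open>f'\<close> on the exceptional null set keeps its integral and makes the
  comparison hold everywhere.\<close>

lemma abs_continuous_diff_ge_integral:
  fixes f f' g :: "real \<Rightarrow> real"
  assumes "a \<le> b" "abs_continuous_on {a..b} f" "g integrable_on {a..b}"
    and ae: "AE x in lebesgue. x \<in> {a..b} \<longrightarrow> (f has_real_derivative f' x) (at x) \<and> g x \<le> f' x"
  shows "integral {a..b} g \<le> f b - f a"
proof -
  obtain N where N: "negligible N" "\<And>x. x \<in> {a..b} - N \<Longrightarrow> (f has_real_derivative f' x) (at x) \<and> g x \<le> f' x"
    using ae by (auto simp: eventually_ae_filter negligible_iff_null_sets)
  have f': "(f' has_integral (f b - f a)) {a..b}"
    using N assms by (intro fundamental_theorem_of_calculus_abs_continuous[of _ _ _ N])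
      (auto intro: has_field_derivative_at_within)
  define h where "h x = (if x \<in> N then f' x else g x)" for x
  have "(h has_integral integral {a..b} g) {a..b}"
    using has_integral_spike[OF N(1), of "{a..b}" h g] assms(3) by (auto simp: h_def)
  then have "integral {a..b} g \<le> f b - f a"
    using N f' by (elim has_integral_le) (auto simp: h_def)
  then show ?thesis .
qed

section \<open>Primitives of locally integrable functions\<close>

lemma loc_integrable_on_integrable_interval:
  assumes "\<delta> loc_integrable_on {0<..}" "0 < a"
  shows "\<delta> absolutely_integrable_on {a..b}" "\<delta> integrable_on {a..b}"
proof -
  have "{a..b} \<subseteq> {0<..}" using \<open>0 < a\<close> by auto
  then show "\<delta> absolutely_integrable_on {a..b}"
    using assms(1) unfolding loc_integrable_on_def by blast
  then show "\<delta> integrable_on {a..b}"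
    by (rule absolutely_integrable_on_def[THEN iffD1, THEN conjunct1])
qed

text \<open>Truncation: \<open>\<bar>f\<bar>\<close> is split into a part bounded by
  \<open>k\<close> and a remainder \<open>h\<close> of integral below \<open>\<epsilon> / 2\<close>.
  Over short intervals the bounded part contributes at most \<open>k\<close> times their length, and
  the remainder is small over any set.\<close>

lemma abs_continuous_on_indefinite_integral:
  fixes f F :: "real \<Rightarrow> real"
  assumes f: "f absolutely_integrable_on {a..b}"
    and F: "\<And>x y. \<lbrakk>a \<le> x; x \<le> y; y \<le> b\<rbrakk> \<Longrightarrow> F y - F x = integral {x..y} f"
  shows "abs_continuous_on {a..b} F"
  unfolding abs_continuous_on_def
proof (intro allI impI)
  fix \<epsilon> :: real assume "\<epsilon> > 0"
  define g where "g k x = min \<bar>f x\<bar> (real k)" for k x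
  have absf: "(\<lambda>x. \<bar>f x\<bar>) absolutely_integrable_on {a..b}"
    using absolutely_integrable_norm[OF f] by (simp add: o_def)
  have intabs: "(\<lambda>x. \<bar>f x\<bar>) integrable_on {a..b}"
    using absf set_lebesgue_integral_eq_integral(1) by blast
  have g: "g k integrable_on {a..b}" for k
  proof -
    have "(\<lambda>x. min \<bar>f x\<bar> (real k)) absolutely_integrable_on {a..b}"
      by (intro absolutely_integrable_min_1 absf) auto
    then show ?thesis
      unfolding g_def using set_lebesgue_integral_eq_integral(1) by blast
  qed
  have "(\<lambda>k. integral {a..b} (g k)) \<longlonglongrightarrow> integral {a..b} (\<lambda>x. \<bar>f x\<bar>)"
  proof (rule dominated_convergence(2)[OF g intabs])
    show "norm (g k x) \<le> \<bar>f x\<bar>" for k x by (simp add: g_def)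
    show "(\<lambda>k. g k x) \<longlonglongrightarrow> \<bar>f x\<bar>" for x
    proof (rule tendsto_eventually)
      obtain m :: nat where "\<bar>f x\<bar> \<le> real m" using real_arch_simple by blast
      then show "\<forall>\<^sub>F k in sequentially. g k x = \<bar>f x\<bar>"
        unfolding eventually_sequentially g_def by (intro exI[of _ m]) auto
    qed
  qed
  then have "\<forall>\<^sub>F k in sequentially. dist (integral {a..b} (g k)) (integral {a..b} (\<lambda>x. \<bar>f x\<bar>)) < \<epsilon> / 2"
    using \<open>\<epsilon> > 0\<close> by (intro tendstoD) auto
  then obtain k where "dist (integral {a..b} (g k)) (integral {a..b} (\<lambda>x. \<bar>f x\<bar>)) < \<epsilon> / 2"
    by (meson eventually_sequentially order_refl)
  then have k: "integral {a..b} (\<lambda>x. \<bar>f x\<bar>) - integral {a..b} (g k) < \<epsilon> / 2"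
    unfolding dist_real_def by linarith
  define h where "h x = \<bar>f x\<bar> - g k x" for x
  have h: "h integrable_on {a..b}" "\<And>x. h x \<ge> 0" "integral {a..b} h < \<epsilon> / 2"
    using k integral_diff[OF intabs g[of k]] integrable_diff[OF intabs g[of k]]
    by (auto simp: h_def[abs_def] g_def)
  \<comment> \<open>Chosen so that a function bounded by \<open>k + 1\<close> integrates to at most
    \<open>\<epsilon> / 2\<close> over total length \<open>\<eta>\<close>; \<open>k\<close> itself
    could be 0.\<close>
  define \<eta> where "\<eta> = \<epsilon> / (2 * (real k + 1))"
  have "\<eta> > 0" using \<open>\<epsilon> > 0\<close> by (simp add: \<eta>_def)
  have "(\<Sum>i<n. \<bar>F (y i) - F (x i)\<bar>) < \<epsilon>"
    if xy: "\<forall>i<n. x i \<le> y i \<and> {x i..y i} \<subseteq> {a..b}"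
      and disj: "\<forall>i<n. \<forall>j<n. i \<noteq> j \<longrightarrow> {x i<..<y i} \<inter> {x j<..<y j} = {}"
      and less: "(\<Sum>i<n. y i - x i) < \<eta>" for n :: nat and x y :: "nat \<Rightarrow> real"
  proof -
    have sub: "a \<le> x i" "x i \<le> y i" "y i \<le> b" "{x i..y i} \<subseteq> {a..b}" if "i < n" for i
      using xy that by auto
    note int = integrable_subinterval_real[OF _ sub(4)]
    have "\<bar>F (y i) - F (x i)\<bar> \<le> (real k + 1) * (y i - x i) + integral {x i..y i} h" if "i < n" for i
    proof -
      note i = sub[OF that] int[OF intabs that] int[OF h(1) that] int[OF g[of k] that]
      have "f integrable_on {x i..y i}"
        using int[OF _ that] f set_lebesgue_integral_eq_integral(1) by blast
      then have "\<bar>F (y i) - F (x i)\<bar> \<le> integral {x i..y i} (\<lambda>x. \<bar>f x\<bar>)"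
        using i F integral_norm_bound_integral[of f "{x i..y i}" "\<lambda>x. \<bar>f x\<bar>"] by simp
      also have "\<dots> = integral {x i..y i} (\<lambda>x. g k x + h x)"
        by (simp add: h_def)
      also have "\<dots> = integral {x i..y i} (g k) + integral {x i..y i} h"
        using i by (intro integral_add)
      also have "integral {x i..y i} (g k) \<le> integral {x i..y i} (\<lambda>_. real k + 1)"
        using i by (intro integral_le) (auto simp: g_def)
      also have "\<dots> = (real k + 1) * (y i - x i)"
        using i by simp
      finally show ?thesis by simp
    qed
    then have "(\<Sum>i<n. \<bar>F (y i) - F (x i)\<bar>) \<le> (\<Sum>i<n. (real k + 1) * (y i - x i) + integral {x i..y i} h)"
      by (intro sum_mono) auto
    also have "\<dots> = (real k + 1) * (\<Sum>i<n. y i - x i) + (\<Sum>i<n. integral {x i..y i} h)"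
      by (simp add: sum.distrib sum_distrib_left)
    also have "(real k + 1) * (\<Sum>i<n. y i - x i) \<le> (real k + 1) * \<eta>"
      using less by (intro mult_left_mono) auto
    also have "(real k + 1) * \<eta> = \<epsilon> / 2"
      by (simp add: \<eta>_def divide_simps)
    also have "(\<Sum>i<n. integral {x i..y i} h) \<le> integral {a..b} h"
    proof -
      \<comment> \<open>Disjointness of the interiors turns the sum into one integral over a subset
        of \<open>{a..b}\<close>, where \<open>h \<ge> 0\<close> permits comparison with the full
        integral.\<close>
      have "(h has_integral (\<Sum>i\<in>{..<n}. integral {x i..y i} h)) (\<Union>i\<in>{..<n}. {x i<..<y i})"
      proof (rule has_integral_UN)
        show "(h has_integral integral {x i..y i} h) {x i<..<y i}" if "i \<in> {..<n}" for i
          using int[OF h(1)] that by (simp add: has_integral_Icc_iff_Ioo[symmetric] integrable_integral)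
        show "pairwise (\<lambda>i i'. negligible ({x i<..<y i} \<inter> {x i'<..<y i'})) {..<n}"
          using disj by (auto simp: pairwise_def)
      qed simp
      moreover have "(\<Union>i\<in>{..<n}. {x i<..<y i}) \<subseteq> {a..b}"
        using sub by force
      ultimately show ?thesis
        using h by (intro has_integral_subset_le[of _ "{a..b}" h]) auto
    qed
    also note h(3)
    finally show ?thesis by simp
  qed
  with \<open>\<eta> > 0\<close> show "\<exists>\<eta>>0. \<forall>(n::nat) (x::nat \<Rightarrow> real) (y::nat \<Rightarrow> real).
        (\<forall>i<n. x i \<le> y i \<and> {x i..y i} \<subseteq> {a..b}) \<and>
        (\<forall>i<n. \<forall>j<n. i \<noteq> j \<longrightarrow> {x i<..<y i} \<inter> {x j<..<y j} = {}) \<and>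
        (\<Sum>i<n. y i - x i) < \<eta> \<longrightarrow> (\<Sum>i<n. \<bar>F (y i) - F (x i)\<bar>) < \<epsilon>"
    by blast
qed

text \<open>Lebesgue differentiation in the form \<open>integrable_ccontinuous_explicit\<close>
  concerns averages over intervals to the right of a point. Applied also to the reflected function,
  it gives the left averages, and the two together give a two-sided derivative.\<close>

lemma indefinite_integral_has_derivative_AE:
  fixes f F :: "real \<Rightarrow> real"
  assumes f: "f integrable_on {a..b}"
    and F: "\<And>x y. \<lbrakk>a \<le> x; x \<le> y; y \<le> b\<rbrakk> \<Longrightarrow> F y - F x = integral {x..y} f"
  shows "AE t in lebesgue. t \<in> {a<..<b} \<longrightarrow> (F has_real_derivative f t) (at t)"
proof -
  \<comment> \<open>Extension by 0 makes the function integrable on every bounded interval, as the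
    differentiation theorem requires.\<close>
  define g where "g x = (if x \<in> {a..b} then f x else 0)" for x
  have g: "g integrable_on {c..d}" for c d
  proof -
    have "f integrable_on ({a..b} \<inter> {c..d})"
      using f integrable_subinterval_real[OF f] by (auto simp: Int_atLeastAtMost)
    then show ?thesis
      unfolding g_def integrable_restrict_Int .
  qed
  obtain N1 where N1: "negligible N1" "\<And>x e. \<lbrakk>x \<notin> N1; 0 < e\<rbrakk> \<Longrightarrow>
       \<exists>d>0. \<forall>h. 0 < h \<and> h < d \<longrightarrow> norm (integral (cbox x (x + h *\<^sub>R One)) g /\<^sub>R h ^ DIM(real) - g x) < e"
    using integrable_ccontinuous_explicit[of g] g by (metis interval_cbox)
  have "(\<lambda>x. g (- x)) integrable_on {c..d}" for c d
    using g Henstock_Kurzweil_Integration.integrable_reflect_real[where f = g and a = "- d" and b = "- c"] by simp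
  then obtain N2 where N2: "negligible N2" "\<And>x e. \<lbrakk>x \<notin> N2; 0 < e\<rbrakk> \<Longrightarrow>
       \<exists>d>0. \<forall>h. 0 < h \<and> h < d \<longrightarrow>
         norm (integral (cbox x (x + h *\<^sub>R One)) (\<lambda>x. g (- x)) /\<^sub>R h ^ DIM(real) - g (- x)) < e"
    using integrable_ccontinuous_explicit[of "\<lambda>x. g (- x)"] by (metis interval_cbox)
  \<comment> \<open>The exceptional set of the reflected function has to be reflected back.\<close>
  have "negligible (uminus ` N2)"
    using N2(1) by (intro negligible_differentiable_image_negligible) (auto intro!: derivative_intros)
  then have null: "N1 \<union> uminus ` N2 \<in> null_sets lebesgue"
    using N1(1) by (simp add: negligible_iff_null_sets[symmetric])
  show ?thesis
  proof (rule AE_I'[OF null], intro subsetI, rule ccontr)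
    fix t assume "t \<in> {t \<in> space lebesgue. \<not> (t \<in> {a<..<b} \<longrightarrow> (F has_real_derivative f t) (at t))}"
    then have t: "a < t" "t < b" and not: "\<not> (F has_real_derivative f t) (at t)" by auto
    assume "t \<notin> N1 \<union> uminus ` N2"
    then have tN: "t \<notin> N1" "- t \<notin> N2" by (auto, force)
    have "(F has_real_derivative f t) (at t)"
      unfolding DERIV_def LIM_eq
    proof (intro allI impI)
      fix r :: real assume "r > 0"
      obtain d1 where d1: "d1 > 0" "\<And>h. 0 < h \<Longrightarrow> h < d1 \<Longrightarrow> \<bar>integral {t..t + h} g / h - g t\<bar> < r"
        using N1(2)[OF tN(1) \<open>r > 0\<close>] by (auto simp: divide_inverse mult.commute)
      obtain d2 where d2: "d2 > 0"
        "\<And>h. 0 < h \<Longrightarrow> h < d2 \<Longrightarrow> \<bar>integral {- t..- t + h} (\<lambda>x. g (- x)) / h - g t\<bar> < r"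
        using N2(2)[OF tN(2) \<open>r > 0\<close>] by (auto simp: divide_inverse mult.commute)
      have gf: "integral {x..y} g = F y - F x" if "a \<le> x" "x \<le> y" "y \<le> b" for x y
      proof -
        have "integral {x..y} g = integral {x..y} f"
          using that by (intro integral_cong) (auto simp: g_def)
        then show ?thesis using F that by simp
      qed
      \<comment> \<open>Besides both differentiation radii, \<open>s\<close> keeps
        \<open>t + h\<close> inside \<open>{a..b}\<close>, where \<open>F\<close> is known to be a
        primitive.\<close>
      define s where "s = min (min d1 d2) (min (t - a) (b - t))"
      have "s > 0" using t d1 d2 by (simp add: s_def)
      moreover have "norm ((F (t + h) - F t) / h - f t) < r" if "h \<noteq> 0" "norm h < s" for h
      proof (cases "h > 0")
        case True
        then show ?thesis
          using d1(2)[of h] that t gf[of t "t + h"] by (simp add: s_def g_def)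
      next
        case False
        have "integral {- t..- t + (- h)} (\<lambda>x. g (- x)) = integral {t + h..t} g"
          using Henstock_Kurzweil_Integration.integral_reflect_real[where f = g and a = "t + h" and b = t] by simp
        also have "\<dots> = F t - F (t + h)"
          using False that t by (intro gf) (auto simp: s_def)
        finally have "integral {- t..- t + (- h)} (\<lambda>x. g (- x)) / (- h) = (F (t + h) - F t) / h"
          by (simp add: divide_simps)
        then show ?thesis
          using d2(2)[of "- h"] that t False by (simp add: s_def g_def)
      qed
      ultimately show "\<exists>s>0. \<forall>h. h \<noteq> 0 \<and> norm (h - 0) < s \<longrightarrow> norm ((F (t + h) - F t) / h - f t) < r"
        by auto
    qed
    with not show False by simp
  qed
qed

lemma loc_integrable_primitive:
  fixes f :: "real \<Rightarrow> real"
  assumes f: "f loc_integrable_on {0<..}"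
  obtains F where "\<And>a b. 0 < a \<Longrightarrow> abs_continuous_on {a..b} F"
    "AE t in lebesgue. t > 0 \<longrightarrow> (F has_real_derivative f t) (at t)"
proof -
  note absint = loc_integrable_on_integrable_interval(1)[OF f]
  note int = loc_integrable_on_integrable_interval(2)[OF f]
  \<comment> \<open>The base point is 1 because \<open>f\<close> need not be integrable up to 0. For
    each \<open>t\<close> at least one of the two integrals runs over an empty or one-point interval
    and vanishes, so this is the signed integral from 1 to \<open>t\<close>.\<close>
  define F where "F t = integral {1..t} f - integral {t..1} f" for t
  have comb: "integral {a..c} f + integral {c..b} f = integral {a..b} f" if "0 < a" "a \<le> c" "c \<le> b" for a b c
    using that int by (intro Henstock_Kurzweil_Integration.integral_combine)
  have null: "integral {s..r} f = 0" if "r \<le> s" for r s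
    using that by (cases "r = s") auto
  have F: "F y - F x = integral {x..y} f" if "0 < x" "x \<le> y" for x y
  proof -
    consider "1 \<le> x" | "x \<le> 1" "1 \<le> y" | "y \<le> 1" by linarith
    then show ?thesis
    proof cases
      case 1
      have "integral {x..1} f = 0" "integral {y..1} f = 0"
        using 1 that by (auto intro!: null)
      then show ?thesis using comb[of 1 x y] 1 that by (simp add: F_def)
    next
      case 2
      have "integral {1..x} f = 0" "integral {y..1} f = 0"
        using 2 that by (auto intro!: null)
      then show ?thesis using comb[of x 1 y] 2 that by (simp add: F_def)
    next
      case 3
      have "integral {1..x} f = 0" "integral {1..y} f = 0"
        using 3 that by (auto intro!: null)
      then show ?thesis using comb[of x y 1] 3 that by (simp add: F_def)
    qed
  qed
  show thesis
  proof (rule that)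
    show "abs_continuous_on {a..b} F" if "0 < a" for a b
      using that by (intro abs_continuous_on_indefinite_integral[OF absint] F) auto
    \<comment> \<open>Countably many intervals exhaust the open half-line, so the exceptional null
      sets may be united.\<close>
    have "AE t in lebesgue. t \<in> {inverse (real (Suc n))<..<real (Suc n)} \<longrightarrow> (F has_real_derivative f t) (at t)" for n
    proof (rule indefinite_integral_has_derivative_AE)
      show "f integrable_on {inverse (real (Suc n))..real (Suc n)}" by (intro int) simp
      fix x y assume "inverse (real (Suc n)) \<le> x" "x \<le> y"
      moreover have "inverse (real (Suc n)) > 0" by simp
      ultimately show "F y - F x = integral {x..y} f" by (intro F) linarith+
    qed
    then have "AE t in lebesgue. \<forall>n. t \<in> {inverse (real (Suc n))<..<real (Suc n)} \<longrightarrow> (F has_real_derivative f t) (at t)"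
      unfolding AE_all_countable ..
    then show "AE t in lebesgue. t > 0 \<longrightarrow> (F has_real_derivative f t) (at t)"
    proof eventually_elim
      case (elim t)
      show ?case
      proof
        assume "t > 0"
        then obtain n where n: "inverse (real (Suc n)) < t" using reals_Archimedean by blast
        obtain m where m: "t < real m" using reals_Archimedean2 by blast
        have "inverse (real (Suc (max n m))) \<le> inverse (real (Suc n))"
          by (intro le_imp_inverse_le) auto
        then have "inverse (real (Suc (max n m))) < t" "t < real (Suc (max n m))"
          using n m by linarith+
        then show "(F has_real_derivative f t) (at t)" using elim[rule_format, of "max n m"] by simp
      qed
    qed
  qed
qed

section \<open>Energy estimates\<close>

lemma is_solutionD:
  assumes "is_solution lam \<delta> u"
  shows "t > 0 \<Longrightarrow> (u has_real_derivative deriv u t) (at t)"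
    and "continuous_on {0<..} (deriv u)"
    and "0 < a \<Longrightarrow> abs_continuous_on {a..b} (deriv u)"
    and "AE t in lebesgue. t > 0 \<longrightarrow>
      (deriv u has_real_derivative - (2 * \<delta> t * deriv u t + lam\<^sup>2 * u t)) (at t)"
proof -
  note sol = assms[unfolded is_solution_def]
  show "t > 0 \<Longrightarrow> (u has_real_derivative deriv u t) (at t)"
    using sol DERIV_deriv_iff_field_differentiable by blast
  show "continuous_on {0<..} (deriv u)" using sol by blast
  show "abs_continuous_on {a..b} (deriv u)" if "0 < a"
  proof (cases "a \<le> b")
    case True
    moreover have "{a..b} \<subseteq> {0<..}" using \<open>0 < a\<close> by auto
    ultimately show ?thesis using sol unfolding loc_abs_continuous_on_def by blast
  next
    case False
    then show ?thesis
      using abs_continuous_on_continuous_deriv[of a b "deriv u" "\<lambda>_. 0"] by simp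
  qed
  have "AE t in lebesgue. t > 0 \<longrightarrow> deriv u field_differentiable at t \<and>
        deriv (deriv u) t + 2 * \<delta> t * deriv u t + lam\<^sup>2 * u t = 0"
    using sol by blast
  then show "AE t in lebesgue. t > 0 \<longrightarrow>
      (deriv u has_real_derivative - (2 * \<delta> t * deriv u t + lam\<^sup>2 * u t)) (at t)"
  proof eventually_elim
    case (elim t)
    show ?case
    proof
      assume "t > 0"
      with elim have "(deriv u has_real_derivative deriv (deriv u) t) (at t)"
        "deriv (deriv u) t = - (2 * \<delta> t * deriv u t + lam\<^sup>2 * u t)"
        using DERIV_deriv_iff_field_differentiable by (blast, auto)
      then show "(deriv u has_real_derivative - (2 * \<delta> t * deriv u t + lam\<^sup>2 * u t)) (at t)"
        by simp
    qed
  qed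
qed

definition energy :: "real \<Rightarrow> (real \<Rightarrow> real) \<Rightarrow> real \<Rightarrow> real" where
  "energy lam u t = (deriv u t)\<^sup>2 + lam\<^sup>2 * (u t)\<^sup>2"

lemma energy_nonneg: "energy lam u t \<ge> 0"
  by (simp add: energy_def)

text \<open>Squares are products of functions that are bounded on the compact interval;
  \<open>a > 0\<close> keeps that interval away from the possibly singular endpoint 0.\<close>

lemma abs_continuous_on_energy:
  assumes sol: "is_solution lam \<delta> u" and "0 < a"
  shows "abs_continuous_on {a..b} (energy lam u)"
proof -
  have v: "abs_continuous_on {a..b} (deriv u)"
    using is_solutionD(3)[OF sol \<open>0 < a\<close>] .
  have u: "abs_continuous_on {a..b} u"
    using \<open>0 < a\<close> abs_continuous_on_imp_continuous_on[OF v]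
    by (intro abs_continuous_on_continuous_deriv[of _ _ _ "deriv u"] is_solutionD(1)[OF sol]) auto
  have square: "abs_continuous_on {a..b} (\<lambda>x. f x * f x)" if f: "abs_continuous_on {a..b} f" for f
  proof -
    obtain B where "\<And>x. x \<in> {a..b} \<Longrightarrow> \<bar>f x\<bar> \<le> B"
      using continuous_on_interval_bounded abs_continuous_on_imp_continuous_on[OF f] by blast
    then show ?thesis using f by (intro abs_continuous_on_mult)
  qed
  have "abs_continuous_on {a..b} (\<lambda>x. lam\<^sup>2 * (u x * u x))"
    by (rule abs_continuous_on_lipschitz_compose[OF square[OF u], where h = "\<lambda>z. lam\<^sup>2 * z" and L = "lam\<^sup>2"])
       (simp add: abs_mult flip: right_diff_distrib)
  from abs_continuous_on_add[OF square[OF v] this] show ?thesis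
    by (simp add: energy_def[abs_def] power2_eq_square)
qed

text \<open>The derivative of the energy is \<open>-4 \<delta> u'\<^sup>2\<close>, hence that of \<open>ln (energy + e)\<close> is at least
  \<open>-4 \<delta>\<close>; the shift by \<open>e > 0\<close> avoids having to know beforehand that the energy does not vanish.\<close>

lemma energy_ge_exp_integral:
  assumes sol: "is_solution lam \<delta> u" and ab: "0 < a" "a \<le> b"
    and int: "\<delta> integrable_on {a..b}" and nonneg: "\<And>t. t > 0 \<Longrightarrow> \<delta> t \<ge> 0"
  shows "energy lam u a * exp (- 4 * integral {a..b} \<delta>) \<le> energy lam u b"
proof (rule field_le_epsilon)
  fix e :: real assume "e > 0"
  define F where "F t = ln (energy lam u t + e)" for t
  have pos: "energy lam u t + e > 0" for t
    using energy_nonneg[of lam u t] \<open>e > 0\<close> by linarith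
  \<comment> \<open>The shifted logarithm has slope at most \<open>1 / e\<close> on nonnegative
    arguments, so \<open>F\<close> inherits absolute continuity from the energy.\<close>
  have lip: "\<bar>ln (z + e) - ln (w + e)\<bar> \<le> 1 / e * \<bar>z - w\<bar>" if "z \<ge> 0" "w \<ge> 0" for z w :: real
  proof -
    have *: "ln (z + e) - ln (w + e) \<le> 1 / e * \<bar>z - w\<bar>" if "z \<ge> 0" "w \<ge> 0" for z w :: real
    proof -
      have "ln (z + e) - ln (w + e) \<le> (z + e - (w + e)) / (w + e)"
        using that \<open>e > 0\<close> by (intro ln_diff_le) auto
      also have "\<dots> \<le> \<bar>z - w\<bar> / (w + e)"
        using that \<open>e > 0\<close> by (intro divide_right_mono) auto
      also have "\<dots> \<le> \<bar>z - w\<bar> / e"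
        using that \<open>e > 0\<close> by (intro divide_left_mono) auto
      finally show ?thesis by simp
    qed
    show ?thesis
      using *[of z w] *[of w z] that by (simp add: abs_minus_commute abs_le_iff)
  qed
  have ac: "abs_continuous_on {a..b} F"
    unfolding F_def
    by (rule abs_continuous_on_lipschitz_compose[OF abs_continuous_on_energy[OF sol \<open>0 < a\<close>],
          where h = "\<lambda>z. ln (z + e)" and L = "1 / e"])
       (intro lip energy_nonneg)
  have "integral {a..b} (\<lambda>t. - 4 * \<delta> t) \<le> F b - F a"
  proof (rule abs_continuous_diff_ge_integral[OF \<open>a \<le> b\<close> ac])
    show "(\<lambda>t. - 4 * \<delta> t) integrable_on {a..b}"
      using int by (rule integrable_on_mult_right)
    show "AE t in lebesgue. t \<in> {a..b} \<longrightarrow>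
        (F has_real_derivative - 4 * \<delta> t * (deriv u t)\<^sup>2 / (energy lam u t + e)) (at t) \<and>
        - 4 * \<delta> t \<le> - 4 * \<delta> t * (deriv u t)\<^sup>2 / (energy lam u t + e)"
      using is_solutionD(4)[OF sol]
    proof eventually_elim
      case (elim t)
      show ?case
      proof (intro impI conjI)
        assume "t \<in> {a..b}"
        then have "t > 0" using ab by auto
        with elim have v: "(deriv u has_real_derivative - (2 * \<delta> t * deriv u t + lam\<^sup>2 * u t)) (at t)"
          by blast
        have "(energy lam u has_real_derivative - 4 * \<delta> t * (deriv u t)\<^sup>2) (at t)"
          unfolding energy_def[abs_def]
          by (rule derivative_eq_intros v is_solutionD(1)[OF sol \<open>t > 0\<close>] refl)+
             (simp add: algebra_simps power2_eq_square)
        then show "(F has_real_derivative - 4 * \<delta> t * (deriv u t)\<^sup>2 / (energy lam u t + e)) (at t)"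
          unfolding F_def[abs_def] using pos[of t]
          by (auto intro!: derivative_eq_intros simp: field_simps)
        \<comment> \<open>The kinetic term is at most the whole shifted energy, so the logarithmic
          derivative loses at most \<open>4 * \<delta> t\<close>.\<close>
        have "(deriv u t)\<^sup>2 \<le> energy lam u t + e"
          using \<open>e > 0\<close> by (simp add: energy_def)
        then have "(deriv u t)\<^sup>2 / (energy lam u t + e) \<le> 1"
          using pos[of t] by simp
        then have "4 * \<delta> t * ((deriv u t)\<^sup>2 / (energy lam u t + e)) \<le> 4 * \<delta> t * 1"
          using nonneg[OF \<open>t > 0\<close>] by (intro mult_left_mono) auto
        then show "- 4 * \<delta> t \<le> - 4 * \<delta> t * (deriv u t)\<^sup>2 / (energy lam u t + e)"
          by simp
      qed
    qed
  qed
  then have "F a + (- 4 * integral {a..b} \<delta>) \<le> F b"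
    by simp
  then have "exp (F a + (- 4 * integral {a..b} \<delta>)) \<le> exp (F b)"
    by simp
  then have "(energy lam u a + e) * exp (- 4 * integral {a..b} \<delta>) \<le> energy lam u b + e"
    unfolding exp_add F_def using pos by simp
  moreover have "energy lam u a * exp (- 4 * integral {a..b} \<delta>)
      \<le> (energy lam u a + e) * exp (- 4 * integral {a..b} \<delta>)"
    using \<open>e > 0\<close> by (intro mult_right_mono) auto
  ultimately show "energy lam u a * exp (- 4 * integral {a..b} \<delta>) \<le> energy lam u b + e"
    by linarith
qed

text \<open>Since \<open>\<delta>\<close> is nonnegative, its integral over any
  \<open>{t0..t}\<close> is at most that over the half-line. The lower bound for the energy thereby
  becomes a positive constant independent of \<open>t\<close>.\<close>

lemma energy_not_tendsto_0:
  assumes sol: "is_solution lam \<delta> u" and "lam > 0" and loc: "\<delta> loc_integrable_on {0<..}"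
    and nonneg: "\<And>t. t > 0 \<Longrightarrow> \<delta> t \<ge> 0"
    and int: "\<delta> integrable_on {0<..}" and "t0 > 0" "u t0 \<noteq> 0"
  shows "\<not> (energy lam u \<longlongrightarrow> 0) at_top"
proof
  assume lim: "(energy lam u \<longlongrightarrow> 0) at_top"
  define c where "c = energy lam u t0 * exp (- 4 * integral {0<..} \<delta>)"
  have "energy lam u t0 > 0"
    using \<open>lam > 0\<close> \<open>u t0 \<noteq> 0\<close> by (simp add: energy_def add_nonneg_pos)
  then have "c > 0" by (simp add: c_def)
  have "eventually (\<lambda>t. c \<le> energy lam u t) at_top"
    using eventually_ge_at_top[of t0]
  proof eventually_elim
    case (elim t)
    have "integral {t0..t} \<delta> \<le> integral {0<..} \<delta>"
      using \<open>t0 > 0\<close> int nonneg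
      by (intro integral_subset_le loc_integrable_on_integrable_interval[OF loc]) auto
    then have "c \<le> energy lam u t0 * exp (- 4 * integral {t0..t} \<delta>)"
      unfolding c_def using energy_nonneg by (intro mult_left_mono) auto
    also have "\<dots> \<le> energy lam u t"
      using \<open>t0 > 0\<close> elim nonneg
      by (intro energy_ge_exp_integral[OF sol] loc_integrable_on_integrable_interval[OF loc])
    finally show ?case .
  qed
  then have "c \<le> 0"
    using lim by (intro tendsto_lowerbound) auto
  with \<open>c > 0\<close> show False by simp
qed

section \<open>Continuous extension to the endpoint 0\<close>

lemma lipschitz_tendsto_at_right_0:
  fixes f :: "real \<Rightarrow> real"
  assumes "r > 0" and lip: "\<And>x y. \<lbrakk>0 < x; x \<le> y; y \<le> r\<rbrakk> \<Longrightarrow> \<bar>f y - f x\<bar> \<le> L * (y - x)"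
  obtains l where "(f \<longlongrightarrow> l) (at_right 0)"
proof -
  \<comment> \<open>Nonnegativity of \<open>L\<close> is read off from the Lipschitz bound for one
    pair of distinct points.\<close>
  have "0 \<le> L * (r - r / 2)"
    using lip[of "r / 2" r] \<open>r > 0\<close> by linarith
  then have L: "L \<ge> 0"
    using \<open>r > 0\<close> by (simp add: zero_le_mult_iff)
  have "L-lipschitz_on {0<..r} f"
    using L lip by (intro lipschitz_on_leI) (auto simp: dist_real_def abs_minus_commute)
  then have uc: "uniformly_continuous_on {0<..r} f"
    by (rule lipschitz_on_uniformly_continuous)
  \<comment> \<open>A uniformly continuous function has a limit at each point of the closure of its
    domain.\<close>
  have "(0::real) \<in> closure {0<..r}" using \<open>r > 0\<close> by simp
  then obtain l where "(f \<longlongrightarrow> l) (at 0 within {0<..r})"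
    using uniformly_continuous_on_extension_at_closure[OF uc] by blast
  moreover have "at_right (0::real) = at 0 within {0<..r}"
    using \<open>r > 0\<close> by (intro at_within_nhd[of _ "{..<r}"]) auto
  ultimately show thesis using that by simp
qed

lemma ext0_continuous_on:
  assumes cont: "continuous_on {0<..} f" and lim: "(f \<longlongrightarrow> l) (at_right 0)"
  shows "ext0 f 0 = l" "continuous_on {0..} (ext0 f)"
proof -
  show eq: "ext0 f 0 = l"
    using lim by (simp add: ext0_def tendsto_Lim)
  show "continuous_on {0..} (ext0 f)"
    unfolding continuous_on_eq_continuous_within
  proof
    fix x :: real assume "x \<in> {0..}"
    show "continuous (at x within {0..}) (ext0 f)"
    proof (cases "x = 0")
      case True
      have "(ext0 f \<longlongrightarrow> l) (at 0 within {0<..})"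
        using lim by (rule Lim_transform_eventually)
          (auto simp: ext0_def eventually_at_filter)
      moreover have "at (0::real) within {0..} = at 0 within {0<..}"
        by (rule at_within_nhd[of _ UNIV]) auto
      ultimately show ?thesis
        using True eq by (simp add: continuous_within)
    next
      case False
      with \<open>x \<in> {0..}\<close> have "x > 0" by simp
      then have "isCont f x"
        using cont by (simp add: continuous_on_eq_continuous_at)
      moreover have "eventually (\<lambda>t. t > 0) (nhds x)"
        using \<open>x > 0\<close> by (intro eventually_nhds_in_open[of "{0<..}", simplified]) auto
      then have "eventually (\<lambda>t. f t = ext0 f t) (nhds x)"
        by eventually_elim (simp add: ext0_def)
      ultimately have "isCont (ext0 f) x"
        using isCont_cong by blast
      then show ?thesis by (rule continuous_at_imp_continuous_at_within)
    qed
  qed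
qed

lemma solution_limits_at_0:
  assumes sol: "is_solution lam \<delta> u" and "lam > 0" and loc: "\<delta> loc_integrable_on {0<..}"
    and nonneg: "\<And>t. t > 0 \<Longrightarrow> \<delta> t \<ge> 0" and le: "\<And>t. t > 0 \<Longrightarrow> \<delta> t \<le> M"
  obtains l l' where "(u \<longlongrightarrow> l) (at_right 0)" "(deriv u \<longlongrightarrow> l') (at_right 0)"
    "\<And>t. t > 0 \<Longrightarrow> (l'\<^sup>2 + lam\<^sup>2 * l\<^sup>2) * exp (- 4 * M * t) \<le> energy lam u t"
proof -
  have M: "M \<ge> 0" using nonneg[of 1] le[of 1] by simp
  have decay: "energy lam u a * exp (- 4 * M * (b - a)) \<le> energy lam u b" if "0 < a" "a \<le> b" for a b
  proof -
    have "integral {a..b} \<delta> \<le> integral {a..b} (\<lambda>_. M)"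
      using that le by (intro integral_le loc_integrable_on_integrable_interval[OF loc]) auto
    then have "integral {a..b} \<delta> \<le> M * (b - a)" using that by (simp add: mult.commute)
    then have "energy lam u a * exp (- 4 * M * (b - a)) \<le> energy lam u a * exp (- 4 * integral {a..b} \<delta>)"
      using energy_nonneg by (intro mult_left_mono) auto
    also have "\<dots> \<le> energy lam u b"
      using that nonneg
      by (intro energy_ge_exp_integral[OF sol] loc_integrable_on_integrable_interval[OF loc])
    finally show ?thesis .
  qed
  \<comment> \<open>The decay estimate from \<open>t\<close> to 1, read backwards, bounds the energy
    on \<open>(0, 1]\<close> by its value at 1 times \<open>exp (4 * M)\<close>. Hence
    \<open>B\<close> bounds both \<open>\<bar>u'\<bar>\<close> and
    \<open>\<bar>lam * u\<bar>\<close> there.\<close>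
  define B where "B = sqrt (energy lam u 1 * exp (4 * M))"
  have bound: "energy lam u t \<le> energy lam u 1 * exp (4 * M)" if "0 < t" "t \<le> 1" for t
  proof -
    have "energy lam u t * exp (- (4 * M * (1 - t))) \<le> energy lam u 1"
      using decay[of t 1] that by simp
    then have "energy lam u t \<le> energy lam u 1 * exp (4 * M * (1 - t))"
      by (simp only: exp_minus divide_inverse[symmetric] pos_divide_le_eq[OF exp_gt_zero])
    also have "\<dots> \<le> energy lam u 1 * exp (4 * M)"
      using energy_nonneg M that by (intro mult_left_mono) (auto simp: mult_left_le)
    finally show ?thesis .
  qed
  have v: "\<bar>deriv u t\<bar> \<le> B" if "0 < t" "t \<le> 1" for t
  proof -
    have "(deriv u t)\<^sup>2 \<le> energy lam u t" by (simp add: energy_def)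
    then show ?thesis unfolding B_def using bound[OF that] by (intro real_le_rsqrt) simp
  qed
  have u: "\<bar>lam * u t\<bar> \<le> B" if "0 < t" "t \<le> 1" for t
  proof -
    have "(lam * u t)\<^sup>2 \<le> energy lam u t" by (simp add: energy_def power_mult_distrib)
    then show ?thesis unfolding B_def using bound[OF that] by (intro real_le_rsqrt) simp
  qed
  have "\<bar>u y - u x\<bar> \<le> B * (y - x)" if "0 < x" "x \<le> y" "y \<le> 1" for x y
  proof -
    have "norm (u y - u x) \<le> B * norm (y - x)"
      by (rule field_differentiable_bound[of "{x..y}" _ "deriv u"])
         (use that v is_solutionD(1)[OF sol] in \<open>auto intro: has_field_derivative_at_within\<close>)
    then show ?thesis using that by simp
  qed
  then obtain l where l: "(u \<longlongrightarrow> l) (at_right 0)"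
    using lipschitz_tendsto_at_right_0[OF zero_less_one, of u B] by blast
  \<comment> \<open>A bound for \<open>u''\<close> read off from the equation: the damping term is
    at most \<open>2 * M * B\<close>, and \<open>lam\<^sup>2 * u\<close> is \<open>lam\<close> times
    a quantity bounded by \<open>B\<close>. As \<open>u''\<close> exists only almost everywhere, the
    Lipschitz bound for \<open>u'\<close> goes through integration.\<close>
  define C where "C = 2 * M * B + lam * B"
  have "\<bar>deriv u y - deriv u x\<bar> \<le> C * (y - x)" if xy: "0 < x" "x \<le> y" "y \<le> 1" for x y
  proof -
    define w where "w t = - (2 * \<delta> t * deriv u t + lam\<^sup>2 * u t)" for t
    have w: "\<bar>w t\<bar> \<le> C" if "0 < t" "t \<le> 1" for t
    proof -
      have "\<bar>w t\<bar> \<le> \<bar>2 * \<delta> t * deriv u t\<bar> + \<bar>lam * (lam * u t)\<bar>"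
        unfolding w_def power2_eq_square mult.assoc by linarith
      also have "\<bar>2 * \<delta> t * deriv u t\<bar> \<le> 2 * M * B"
        using le[of t] nonneg[of t] v[of t] that M
        unfolding abs_mult by (intro mult_mono) auto
      also have "\<bar>lam * (lam * u t)\<bar> = lam * \<bar>lam * u t\<bar>"
        using \<open>lam > 0\<close> by (simp add: abs_mult)
      also have "lam * \<bar>lam * u t\<bar> \<le> lam * B"
        using u[OF that] \<open>lam > 0\<close> by (intro mult_left_mono) auto
      finally show ?thesis by (simp add: C_def)
    qed
    obtain N where N: "negligible N" "\<And>t. t \<in> - N \<Longrightarrow> t > 0 \<Longrightarrow> (deriv u has_real_derivative w t) (at t)"
      using is_solutionD(4)[OF sol]
      by (auto simp: eventually_ae_filter negligible_iff_null_sets w_def)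
    have "(w has_integral (deriv u y - deriv u x)) {x..y}"
      using xy N is_solutionD(3)[OF sol]
      by (intro fundamental_theorem_of_calculus_abs_continuous[of _ _ _ N])
         (auto intro: has_field_derivative_at_within)
    moreover have "0 \<le> C" using w[of 1] by simp
    ultimately have "norm (deriv u y - deriv u x) \<le> C * measure lborel (cbox x y)"
      using w xy by (intro has_integral_bound[of _ w]) auto
    then show ?thesis using xy by simp
  qed
  then obtain l' where l': "(deriv u \<longlongrightarrow> l') (at_right 0)"
    using lipschitz_tendsto_at_right_0[OF zero_less_one, of "deriv u" C] by blast
  have "(l'\<^sup>2 + lam\<^sup>2 * l\<^sup>2) * exp (- 4 * M * t) \<le> energy lam u t" if "t > 0" for t
  proof (rule tendsto_upperbound)
    \<comment> \<open>The decay estimate on \<open>{a..t}\<close> is passed to the limit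
      \<open>a \<longlongrightarrow> 0\<close> from the right.\<close>
    have "((\<lambda>a. energy lam u a * exp (- 4 * M * (t - a))) \<longlongrightarrow>
        (l'\<^sup>2 + lam\<^sup>2 * l\<^sup>2) * exp (- 4 * M * (t - 0))) (at_right 0)"
      unfolding energy_def by (intro tendsto_intros l l')
    then show "((\<lambda>a. energy lam u a * exp (- 4 * M * (t - a))) \<longlongrightarrow>
        (l'\<^sup>2 + lam\<^sup>2 * l\<^sup>2) * exp (- 4 * M * t)) (at_right 0)" by simp
    show "\<forall>\<^sub>F a in at_right 0. energy lam u a * exp (- 4 * M * (t - a)) \<le> energy lam u t"
      using eventually_at_right_less eventually_at_rightI[of 0 t "\<lambda>a. a \<le> t", OF _ \<open>t > 0\<close>]
      by (smt (verit) decay eventually_elim2 greaterThanLessThan_iff)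
  qed simp
  with l l' show thesis using that by blast
qed

section \<open>Linear systems with continuous coefficients\<close>

text \<open>The primitive that vanishes at \<open>c\<close> is the integral from \<open>c\<close>,
  which is what one Picard step needs on the whole open half-line.\<close>

lemma primitive_exists_halfline:
  fixes f :: "real \<Rightarrow> real"
  assumes "continuous_on {0<..} f"
  shows "\<exists>F. F c = 0 \<and> (\<forall>t>0. (F has_real_derivative f t) (at t))"
proof -
  obtain F where F: "\<forall>t::real. (0::ereal) < t \<longrightarrow> t < (\<infinity>::ereal) \<longrightarrow> (F has_vector_derivative f t) (at t)"
    using einterval_antiderivative[of 0 \<infinity> f] assms by (auto simp: continuous_on_eq_continuous_at)
  have "\<forall>t>0. ((\<lambda>t. F t - F c) has_real_derivative f t) (at t)"
    using F by (auto simp: has_real_derivative_iff_has_vector_derivative intro!: derivative_eq_intros)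
  then show ?thesis by (intro exI[of _ "\<lambda>t. F t - F c"]) simp
qed

text \<open>Integrating \<open>K * \<bar>s - c\<bar> ^ n\<close> away from \<open>c\<close> gains
  one power and the factor \<open>1 / (n + 1)\<close>; iterated, this produces the factorials of the
  Picard estimate.\<close>

lemma abs_le_power_of_derivative_bound:
  fixes F :: "real \<Rightarrow> real"
  assumes c: "c \<in> {\<alpha>..\<beta>}" and t: "t \<in> {\<alpha>..\<beta>}" and "F c = 0"
    and der: "\<And>s. s \<in> {\<alpha>..\<beta>} \<Longrightarrow> (F has_real_derivative f s) (at s)"
    and le: "\<And>s. s \<in> {\<alpha>..\<beta>} \<Longrightarrow> \<bar>f s\<bar> \<le> K * \<bar>s - c\<bar> ^ n"
  shows "\<bar>F t\<bar> \<le> K * \<bar>t - c\<bar> ^ Suc n / real (Suc n)"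
proof -
  have main: "G r \<le> K * r ^ Suc n / real (Suc n)"
    if "0 \<le> r" "G 0 = 0" and G: "\<And>s. 0 \<le> s \<Longrightarrow> s \<le> r \<Longrightarrow> (G has_real_derivative g s) (at s) \<and> g s \<le> K * s ^ n"
    for G g :: "real \<Rightarrow> real" and r
  proof -
    define H where "H s = K * s ^ Suc n / real (Suc n) - G s" for s
    have "H 0 \<le> H r"
    proof (rule DERIV_nonneg_imp_nondecreasing[OF \<open>0 \<le> r\<close>])
      fix s assume s: "0 \<le> s" "s \<le> r"
      have *: "((\<lambda>s. K * s ^ Suc n / real (Suc n)) has_real_derivative K * s ^ n) (at s)"
        by (rule derivative_eq_intros refl | simp)+
      have "(H has_real_derivative (K * s ^ n - g s)) (at s)"
        unfolding H_def[abs_def] using G[OF s] * by (intro DERIV_diff) auto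
      then show "\<exists>z. DERIV H s :> z \<and> 0 \<le> z" using G[OF s] by auto
    qed
    then show ?thesis using \<open>G 0 = 0\<close> by (simp add: H_def)
  qed
  \<comment> \<open>\<open>\<tau>\<close> is the direction in which \<open>t\<close> lies from
    \<open>c\<close> and \<open>\<sigma>\<close> the sign of \<open>F\<close> under study; both
    reduce to the one-sided comparison above.\<close>
  have shift: "((\<lambda>s. \<sigma> * F (c + \<tau> * s)) has_real_derivative \<sigma> * (f (c + \<tau> * s) * \<tau>)) (at s)"
    if "c + \<tau> * s \<in> {\<alpha>..\<beta>}" for \<sigma> \<tau> s :: real
    using that
    by (intro DERIV_cmult DERIV_chain2[OF der]) (auto intro!: derivative_eq_intros)
  have signed: "\<sigma> * F t \<le> K * \<bar>t - c\<bar> ^ Suc n / real (Suc n)" if \<sigma>: "\<bar>\<sigma>\<bar> = 1" for \<sigma>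
  proof -
    define \<tau> :: real where "\<tau> = (if c \<le> t then 1 else -1)"
    have \<tau>: "c + \<tau> * \<bar>t - c\<bar> = t" "\<bar>\<tau>\<bar> = 1" by (auto simp: \<tau>_def)
    have "\<sigma> * F (c + \<tau> * \<bar>t - c\<bar>) \<le> K * \<bar>t - c\<bar> ^ Suc n / real (Suc n)"
    proof (rule main)
      fix s assume s: "0 \<le> s" "s \<le> \<bar>t - c\<bar>"
      have I: "c + \<tau> * s \<in> {\<alpha>..\<beta>}"
        using s c t by (auto simp: \<tau>_def split: if_splits)
      have "\<sigma> * (f (c + \<tau> * s) * \<tau>) \<le> \<bar>\<sigma> * (f (c + \<tau> * s) * \<tau>)\<bar>" by (rule abs_ge_self)
      also have "\<dots> = \<bar>f (c + \<tau> * s)\<bar>" using \<sigma> \<tau>(2) by (simp add: abs_mult)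
      also have "\<dots> \<le> K * \<bar>c + \<tau> * s - c\<bar> ^ n" by (rule le[OF I])
      also have "\<dots> = K * s ^ n" using s \<tau>(2) by (simp add: abs_mult)
      finally show "((\<lambda>s. \<sigma> * F (c + \<tau> * s)) has_real_derivative \<sigma> * (f (c + \<tau> * s) * \<tau>)) (at s) \<and>
          \<sigma> * (f (c + \<tau> * s) * \<tau>) \<le> K * s ^ n"
        using shift[OF I] by blast
    qed (use \<open>F c = 0\<close> in auto)
    then show ?thesis by (simp only: \<tau>)
  qed
  show ?thesis
    using signed[of 1] signed[of "-1"] by (simp add: abs_le_iff)
qed

text \<open>Picard iteration: the \<open>n\<close>-th iterate is bounded by \<open>C A\<^sup>n \<bar>t - c\<bar>\<^sup>n / n!\<close> on every compact
  interval, so the iterates can be summed and differentiated term by term.\<close>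

lemma linear_system_solution_exists:
  fixes a b :: "real \<Rightarrow> real"
  assumes a: "continuous_on {0<..} a" and b: "continuous_on {0<..} b" and "c > 0"
  obtains u w where "u c = x0" "w c = y0"
    "\<And>t. t > 0 \<Longrightarrow> (u has_real_derivative a t * w t) (at t)"
    "\<And>t. t > 0 \<Longrightarrow> (w has_real_derivative b t * u t) (at t)"
proof -
  \<comment> \<open>\<open>P\<close> records the continuity needed to integrate once more and the
    constant starting pair; \<open>Q\<close> says that the next pair is the Picard integral from
    \<open>c\<close> of the current one. The iterates are then picked by dependent choice.\<close>
  define P where "P n X \<longleftrightarrow> continuous_on {0<..} (fst X) \<and> continuous_on {0<..} (snd X) \<and>
      (n = 0 \<longrightarrow> X = (\<lambda>_. x0, \<lambda>_. y0))" for n :: nat and X :: "(real \<Rightarrow> real) \<times> (real \<Rightarrow> real)"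
  define Q where "Q X Y \<longleftrightarrow> fst Y c = 0 \<and> snd Y c = 0 \<and>
      (\<forall>t>0. (fst Y has_real_derivative a t * snd X t) (at t) \<and>
         (snd Y has_real_derivative b t * fst X t) (at t))" for X Y
  have "\<exists>X. \<forall>n. P n (X n) \<and> Q (X n) (X (Suc n))"
  proof (rule dependent_nat_choice)
    show "\<exists>X. P 0 X" by (auto simp: P_def)
    fix X n assume "P n X"
    then have X: "continuous_on {0<..} (fst X)" "continuous_on {0<..} (snd X)" by (auto simp: P_def)
    obtain F where F: "F c = 0" "\<forall>t>0. (F has_real_derivative a t * snd X t) (at t)"
      using primitive_exists_halfline[of "\<lambda>t. a t * snd X t"] a X continuous_on_mult by blast
    obtain G where G: "G c = 0" "\<forall>t>0. (G has_real_derivative b t * fst X t) (at t)"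
      using primitive_exists_halfline[of "\<lambda>t. b t * fst X t"] b X continuous_on_mult by blast
    have "continuous_on {0<..} F" "continuous_on {0<..} G"
      using F G by (auto intro!: continuous_at_imp_continuous_on intro: DERIV_isCont)
    then show "\<exists>Y. P (Suc n) Y \<and> Q X Y"
      using F G by (intro exI[of _ "(F, G)"]) (auto simp: P_def Q_def)
  qed
  then obtain X where X: "\<And>n. P n (X n)" "\<And>n. Q (X n) (X (Suc n))" by blast
  define u w where "u n = fst (X n)" and "w n = snd (X n)" for n
  have init: "u 0 = (\<lambda>_. x0)" "w 0 = (\<lambda>_. y0)" using X(1)[of 0] by (auto simp: P_def u_def w_def)
  have step: "u (Suc n) c = 0" "w (Suc n) c = 0"
    "t > 0 \<Longrightarrow> (u (Suc n) has_real_derivative a t * w n t) (at t)"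
    "t > 0 \<Longrightarrow> (w (Suc n) has_real_derivative b t * u n t) (at t)" for n t
    using X(2)[of n] by (auto simp: Q_def u_def w_def)
  define C where "C = \<bar>x0\<bar> + \<bar>y0\<bar>"
  define U W where "U t = (\<Sum>n. u n t)" and "W t = (\<Sum>n. w n t)" for t

  have series: "((\<lambda>t. \<Sum>n. f n t) has_real_derivative p t * (\<Sum>n. g n t)) (at t)"
    if f0: "\<And>t. f 0 t = z" and fS: "\<And>n t. t > 0 \<Longrightarrow> (f (Suc n) has_real_derivative p t * g n t) (at t)"
      and S: "\<alpha> > 0" "t \<in> {\<alpha><..<\<beta>}" and p: "\<And>t. t \<in> {\<alpha>..\<beta>} \<Longrightarrow> \<bar>p t\<bar> \<le> A"
      and M: "summable M" "\<And>n t. t \<in> {\<alpha>..\<beta>} \<Longrightarrow> \<bar>f n t\<bar> \<le> M n"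
        "\<And>n t. t \<in> {\<alpha>..\<beta>} \<Longrightarrow> \<bar>g n t\<bar> \<le> M n"
    for f g :: "nat \<Rightarrow> real \<Rightarrow> real" and p t z \<alpha> \<beta> A and M :: "nat \<Rightarrow> real"
  proof -
    \<comment> \<open>The index shift behind the construction: the constant term has derivative 0
      and each later term is differentiated into its predecessor, so the differentiated series is
      \<open>p t\<close> times the other series.\<close>
    define f' where "f' n t = (case n of 0 \<Rightarrow> 0 | Suc m \<Rightarrow> p t * g m t)" for n t
    have tI: "t \<in> {\<alpha>..\<beta>}" using S by auto
    have "((\<lambda>t. \<Sum>n. f n t) has_field_derivative (\<Sum>n. f' n t)) (at t)"
    proof (rule has_field_derivative_series'(2))
      show "convex {\<alpha>..\<beta>}" by simp
      show "t \<in> {\<alpha>..\<beta>}" by fact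
      show "t \<in> interior {\<alpha>..\<beta>}" using S by simp
      show "summable (\<lambda>n. f n t)"
        using M tI by (intro summable_comparison_test[OF _ M(1)]) auto
      show "(f n has_field_derivative f' n x) (at x within {\<alpha>..\<beta>})" if "x \<in> {\<alpha>..\<beta>}" for n x
      proof (cases n)
        case 0
        have "f 0 = (\<lambda>_. z)" using f0 by blast
        then show ?thesis using 0 by (simp add: f'_def)
      next
        case (Suc m)
        then show ?thesis using fS[of x m] that S
          by (auto simp: f'_def intro: has_field_derivative_at_within)
      qed
      show "uniformly_convergent_on {\<alpha>..\<beta>} (\<lambda>n x. \<Sum>i<n. f' i x)"
      proof (rule Weierstrass_m_test')
        show "norm (f' n x) \<le> (case n of 0 \<Rightarrow> 0 | Suc m \<Rightarrow> A * M m)" if "x \<in> {\<alpha>..\<beta>}" for n x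
          using p[OF that] M(3)[OF that]
          by (cases n) (auto simp: f'_def abs_mult intro!: mult_mono intro: order_trans[OF abs_ge_zero])
        show "summable (\<lambda>n. case n of 0 \<Rightarrow> 0 | Suc m \<Rightarrow> A * M m)"
          using M(1) by (subst summable_Suc_iff[symmetric]) (simp add: summable_mult)
      qed
    qed
    moreover have g: "summable (\<lambda>n. g n t)"
      using M tI by (intro summable_comparison_test[OF _ M(1)]) auto
    have "(\<Sum>n. f' n t) = p t * (\<Sum>n. g n t)"
    proof -
      have "summable (\<lambda>n. f' (Suc n) t)" using g by (simp add: f'_def summable_mult)
      then have "summable (\<lambda>n. f' n t)" using summable_Suc_iff[of "\<lambda>n. f' n t"] by blast
      from suminf_split_head[OF this] show ?thesis
        using suminf_mult[OF g] by (simp add: f'_def)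
    qed
    ultimately show ?thesis by simp
  qed

  have "(U has_real_derivative a t * W t) (at t) \<and> (W has_real_derivative b t * U t) (at t)" if "t > 0" for t
  proof -
    \<comment> \<open>A compact interval inside the open half-line that contains \<open>c\<close>
      and has \<open>t\<close> in its interior, where termwise differentiation is available.\<close>
    define \<alpha> \<beta> where "\<alpha> = min c t / 2" and "\<beta> = max c t + 1"
    have ab: "\<alpha> > 0" "c \<in> {\<alpha>..\<beta>}" "t \<in> {\<alpha><..<\<beta>}" "\<alpha> \<le> \<beta>"
      using \<open>t > 0\<close> \<open>c > 0\<close> by (auto simp: \<alpha>_def \<beta>_def min_def max_def)
    have sub: "{\<alpha>..\<beta>} \<subseteq> {0<..}" using ab by auto
    obtain Aa where Aa: "\<And>s. s \<in> {\<alpha>..\<beta>} \<Longrightarrow> \<bar>a s\<bar> \<le> Aa"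
      using continuous_on_interval_bounded[OF continuous_on_subset[OF a sub]] by blast
    obtain Ab where Ab: "\<And>s. s \<in> {\<alpha>..\<beta>} \<Longrightarrow> \<bar>b s\<bar> \<le> Ab"
      using continuous_on_interval_bounded[OF continuous_on_subset[OF b sub]] by blast
    define A where "A = max Aa Ab"
    have A: "\<bar>a s\<bar> \<le> A" "\<bar>b s\<bar> \<le> A" if "s \<in> {\<alpha>..\<beta>}" for s
      using Aa[OF that] Ab[OF that] by (auto simp: A_def)
    have "A \<ge> 0" using A(1)[OF ab(2)] by linarith
    have bound: "\<forall>s\<in>{\<alpha>..\<beta>}. \<bar>u n s\<bar> \<le> C * A ^ n * \<bar>s - c\<bar> ^ n / fact n \<and> \<bar>w n s\<bar> \<le> C * A ^ n * \<bar>s - c\<bar> ^ n / fact n" for n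
    proof (induction n)
      case 0
      then show ?case by (simp add: init C_def)
    next
      case (Suc n)
      have prod: "\<bar>x * y\<bar> \<le> (C * A ^ Suc n / fact n) * r"
        if "\<bar>x\<bar> \<le> A" "\<bar>y\<bar> \<le> C * A ^ n * r / fact n" for x y r
      proof -
        have "\<bar>x\<bar> * \<bar>y\<bar> \<le> A * (C * A ^ n * r / fact n)"
          using that \<open>A \<ge> 0\<close> by (intro mult_mono) auto
        then show ?thesis by (simp add: abs_mult mult_ac)
      qed
      have fact: "C * A ^ Suc n / fact n * r / real (Suc n) = C * A ^ Suc n * r / fact (Suc n)" for r
        by (simp add: field_simps)
      show ?case
      proof (intro ballI conjI)
        fix s assume s: "s \<in> {\<alpha>..\<beta>}"
        have "\<bar>u (Suc n) s\<bar> \<le> (C * A ^ Suc n / fact n) * \<bar>s - c\<bar> ^ Suc n / real (Suc n)"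
        proof (rule abs_le_power_of_derivative_bound[OF ab(2) s, where f = "\<lambda>t. a t * w n t"])
          fix r assume r: "r \<in> {\<alpha>..\<beta>}"
          then show "(u (Suc n) has_real_derivative a r * w n r) (at r)"
            using sub by (intro step) auto
          show "\<bar>a r * w n r\<bar> \<le> C * A ^ Suc n / fact n * \<bar>r - c\<bar> ^ n"
            using Suc.IH A[OF r] r by (intro prod) blast+
        qed (rule step)
        then show "\<bar>u (Suc n) s\<bar> \<le> C * A ^ Suc n * \<bar>s - c\<bar> ^ Suc n / fact (Suc n)"
          by (simp only: fact)
        have "\<bar>w (Suc n) s\<bar> \<le> (C * A ^ Suc n / fact n) * \<bar>s - c\<bar> ^ Suc n / real (Suc n)"
        proof (rule abs_le_power_of_derivative_bound[OF ab(2) s, where f = "\<lambda>t. b t * u n t"])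
          fix r assume r: "r \<in> {\<alpha>..\<beta>}"
          then show "(w (Suc n) has_real_derivative b r * u n r) (at r)"
            using sub by (intro step) auto
          show "\<bar>b r * u n r\<bar> \<le> C * A ^ Suc n / fact n * \<bar>r - c\<bar> ^ n"
            using Suc.IH A[OF r] r by (intro prod) blast+
        qed (rule step)
        then show "\<bar>w (Suc n) s\<bar> \<le> C * A ^ Suc n * \<bar>s - c\<bar> ^ Suc n / fact (Suc n)"
          by (simp only: fact)
      qed
    qed
    \<comment> \<open>Bounding \<open>\<bar>s - c\<bar>\<close> by the length of the interval leaves
      the terms of an exponential series, a majorant independent of \<open>s\<close>.\<close>
    define M where "M n = C * (inverse (fact n) * (A * (\<beta> - \<alpha>)) ^ n)" for n
    have "summable M" unfolding M_def by (intro summable_mult summable_exp)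
    have le: "C * A ^ n * \<bar>s - c\<bar> ^ n / fact n \<le> M n" if "s \<in> {\<alpha>..\<beta>}" for s n
    proof -
      have "\<bar>s - c\<bar> ^ n \<le> (\<beta> - \<alpha>) ^ n"
        using that ab by (intro power_mono) auto
      then have "C * A ^ n / fact n * \<bar>s - c\<bar> ^ n \<le> C * A ^ n / fact n * (\<beta> - \<alpha>) ^ n"
        using \<open>A \<ge> 0\<close> by (intro mult_left_mono) (auto simp: C_def)
      then show ?thesis by (simp add: M_def power_mult_distrib divide_inverse mult_ac)
    qed
    have M: "\<bar>u n s\<bar> \<le> M n" "\<bar>w n s\<bar> \<le> M n" if "s \<in> {\<alpha>..\<beta>}" for n s
      using bound[of n] le[OF that, of n] that by force+
    show ?thesis
      unfolding U_def[abs_def] W_def[abs_def]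
      using series[of u x0 a w \<alpha> t \<beta> A M] series[of w y0 b u \<alpha> t \<beta> A M] init step ab A M \<open>summable M\<close>
      by simp
  qed
  \<comment> \<open>All terms of positive index vanish at \<open>c\<close>, so only the constant
    starting pair survives.\<close>
  moreover have "U c = x0" "W c = y0"
  proof -
    have "(\<lambda>n. u n c) sums (\<Sum>n\<in>{0}. u n c)" "(\<lambda>n. w n c) sums (\<Sum>n\<in>{0}. w n c)"
      using step(1,2) by (intro sums_finite; auto simp: gr0_conv_Suc)+
    then show "U c = x0" "W c = y0"
      using init by (auto simp: U_def W_def sums_iff)
  qed
  ultimately show thesis using that by blast
qed

section \<open>Overdamped solutions\<close>

text \<open>With \<open>p = exp (2 \<integral>\<delta>)\<close> the equation becomes \<open>(p u')' = -lam\<^sup>2 p u\<close>, a linear system in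
  \<open>(u, p u')\<close> whose coefficients are continuous although \<open>\<delta>\<close> is merely locally integrable.\<close>

lemma solution_exists:
  assumes loc: "\<delta> loc_integrable_on {0<..}" and "c > 0"
  obtains u p where "is_solution lam \<delta> u" "u c = x0" "deriv u c = y0" "\<And>t. p t > 0"
    "\<And>t. t > 0 \<Longrightarrow> ((\<lambda>t. p t * deriv u t) has_real_derivative - (lam\<^sup>2 * p t * u t)) (at t)"
proof -
  obtain D where Dac: "\<And>a b. 0 < a \<Longrightarrow> abs_continuous_on {a..b} D"
    and Dder: "AE t in lebesgue. t > 0 \<longrightarrow> (D has_real_derivative \<delta> t) (at t)"
    using loc_integrable_primitive[OF loc] by blast
  have Dcont: "continuous_on {0<..} D"
  proof (rule continuous_at_imp_continuous_on, intro ballI)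
    fix t :: real assume "t \<in> {0<..}"
    then have "continuous_on {t/2..t+1} D" "t \<in> interior {t/2..t+1}"
      using Dac[of "t/2"] abs_continuous_on_imp_continuous_on by auto
    then show "isCont D t" using continuous_on_interior by blast
  qed
  define p where "p t = exp (2 * D t)" for t
  \<comment> \<open>The reciprocal of \<open>p\<close>, so that \<open>u' = q * w\<close> recovers
    \<open>u'\<close> from the second component \<open>w = p * u'\<close>; this also explains the
    initial value \<open>p c * y0\<close> below.\<close>
  define q where "q t = exp (- 2 * D t)" for t
  have pq: "q t * p t = 1" "p t > 0" for t
    by (simp_all add: p_def q_def flip: exp_add)
  obtain u w where uw: "u c = x0" "w c = p c * y0"
    and u: "\<And>t. t > 0 \<Longrightarrow> (u has_real_derivative q t * w t) (at t)"
    and w: "\<And>t. t > 0 \<Longrightarrow> (w has_real_derivative - (lam\<^sup>2 * p t) * u t) (at t)"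
    by (rule linear_system_solution_exists[of q "\<lambda>t. - (lam\<^sup>2 * p t)" c x0 "p c * y0"])
       (use Dcont \<open>c > 0\<close> in \<open>auto simp: p_def[abs_def] q_def[abs_def] intro!: continuous_intros\<close>)
  have du: "deriv u t = q t * w t" if "t > 0" for t
    using u[OF that] by (rule DERIV_imp_deriv)
  have wp: "w t = p t * deriv u t" if "t > 0" for t
    using pq(1)[of t] du[OF that] by (simp add: mult.assoc[symmetric] mult.commute)
  have wcont: "continuous_on {0<..} w"
    using w by (auto intro!: continuous_at_imp_continuous_on intro: DERIV_isCont)
  have qcont: "continuous_on {0<..} q"
    unfolding q_def[abs_def] using Dcont by (intro continuous_intros)
  have ucont: "continuous_on {0<..} u"
    using u by (auto intro!: continuous_at_imp_continuous_on intro: DERIV_isCont)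
  have pcont: "continuous_on {0<..} p"
    unfolding p_def[abs_def] using Dcont by (intro continuous_intros)
  have ac: "abs_continuous_on {a..b} (deriv u)" if "0 < a" for a b
  proof -
    have sub: "{a..b} \<subseteq> {0<..}" using that by auto
    obtain B where B: "\<And>t. t \<in> {a..b} \<Longrightarrow> \<bar>D t\<bar> \<le> B"
      using continuous_on_interval_bounded[OF continuous_on_subset[OF Dcont sub]] by blast
    \<comment> \<open>\<open>exp\<close> is Lipschitz on the bounded range of \<open>D\<close>, so
      \<open>q\<close> is absolutely continuous.\<close>
    have "\<bar>exp (- 2 * y) - exp (- 2 * x)\<bar> \<le> 2 * exp (2 * B) * \<bar>y - x\<bar>" if "\<bar>x\<bar> \<le> B" "\<bar>y\<bar> \<le> B" for x y :: real
    proof -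
      have "norm (exp (- 2 * y) - exp (- 2 * x)) \<le> 2 * exp (2 * B) * norm (y - x)"
      proof (rule field_differentiable_bound[of "{-B..B}" "\<lambda>z. exp (- 2 * z)" "\<lambda>z. - 2 * exp (- 2 * z)"])
        show "((\<lambda>z. exp (- 2 * z)) has_field_derivative - 2 * exp (- 2 * z)) (at z within {-B..B})" for z :: real
          by (auto intro!: derivative_eq_intros)
      qed (use that in auto)
      then show ?thesis by simp
    qed
    then have q: "abs_continuous_on {a..b} q"
      unfolding q_def[abs_def]
      by (intro abs_continuous_on_lipschitz_compose[OF Dac[OF that], where h = "\<lambda>z. exp (- 2 * z)"]) (use B in auto)
    obtain Bq where Bq: "\<And>t. t \<in> {a..b} \<Longrightarrow> \<bar>q t\<bar> \<le> Bq"
      using continuous_on_interval_bounded[OF continuous_on_subset[OF qcont sub]] by blast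
    obtain Bw where Bw: "\<And>t. t \<in> {a..b} \<Longrightarrow> \<bar>w t\<bar> \<le> Bw"
      using continuous_on_interval_bounded[OF continuous_on_subset[OF wcont sub]] by blast
    have "abs_continuous_on {a..b} w"
    proof (rule abs_continuous_on_continuous_deriv)
      show "continuous_on {a..b} (\<lambda>t. - (lam\<^sup>2 * p t) * u t)"
        using ucont pcont sub by (intro continuous_intros) (auto intro: continuous_on_subset)
    qed (use w sub in auto)
    then have qw: "abs_continuous_on {a..b} (\<lambda>t. q t * w t)"
      using q Bq Bw by (intro abs_continuous_on_mult)
    show ?thesis
    \<comment> \<open>\<open>deriv u\<close> is known to equal \<open>q * w\<close> only for
      positive arguments, so the property is transferred by comparing increments.\<close>
    proof (rule abs_continuous_on_dominated[OF qw qw, of _ 1 0])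
      fix x y assume "x \<le> y" "{x..y} \<subseteq> {a..b}"
      then have "x > 0" "y > 0" using that by auto
      then show "\<bar>deriv u y - deriv u x\<bar> \<le> 1 * \<bar>q y * w y - q x * w x\<bar> + 0 * \<bar>q y * w y - q x * w x\<bar>"
        by (simp add: du)
    qed
  qed
  have "is_solution lam \<delta> u"
    unfolding is_solution_def
  proof (intro conjI allI impI)
    show "u field_differentiable at t" if "t > 0" for t
      using u[OF that] field_differentiable_def by blast
    have "continuous_on {0<..} (\<lambda>t. q t * w t)"
      using qcont wcont by (intro continuous_intros)
    then show "continuous_on {0<..} (deriv u)"
      by (rule continuous_on_eq) (simp add: du)
    show "loc_abs_continuous_on {0<..} (deriv u)"
      unfolding loc_abs_continuous_on_def
    proof (intro allI impI)
      fix a b :: real assume "a \<le> b \<and> {a..b} \<subseteq> {0<..}"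
      then have "0 < a" by auto
      then show "abs_continuous_on {a..b} (deriv u)" by (rule ac)
    qed
    show "AE t in lebesgue. t > 0 \<longrightarrow> deriv u field_differentiable at t \<and>
        deriv (deriv u) t + 2 * \<delta> t * deriv u t + lam\<^sup>2 * u t = 0"
      using Dder
    proof eventually_elim
      case (elim t)
      show ?case
      proof
        assume "t > 0"
        then have D: "(D has_real_derivative \<delta> t) (at t)" using elim by blast
        have q: "(q has_real_derivative - 2 * \<delta> t * q t) (at t)"
          unfolding q_def[abs_def] by (auto intro!: derivative_eq_intros D)
        \<comment> \<open>Differentiating \<open>q\<close> produces the damping term and
          differentiating \<open>w\<close> the term in \<open>u\<close>, where \<open>q\<close> and
          \<open>p\<close> cancel.\<close>
        have "((\<lambda>t. q t * w t) has_real_derivative - 2 * \<delta> t * q t * w t + - (lam\<^sup>2 * p t) * u t * q t) (at t)"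
          by (rule DERIV_mult[OF q w[OF \<open>t > 0\<close>]])
        moreover have "- 2 * \<delta> t * q t * w t + - (lam\<^sup>2 * p t) * u t * q t = - 2 * \<delta> t * deriv u t - lam\<^sup>2 * u t"
        proof -
          have "- (lam\<^sup>2 * p t) * u t * q t = - (lam\<^sup>2 * u t * (q t * p t))"
            by (simp add: mult_ac)
          then show ?thesis using pq(1)[of t] du[OF \<open>t > 0\<close>] by simp
        qed
        ultimately have "((\<lambda>t. q t * w t) has_real_derivative - 2 * \<delta> t * deriv u t - lam\<^sup>2 * u t) (at t)"
          by simp
        then have "(deriv u has_real_derivative - 2 * \<delta> t * deriv u t - lam\<^sup>2 * u t) (at t)"
          by (rule has_field_derivative_transform_within_open[of _ _ _ "{0<..}"]) (use \<open>t > 0\<close> du in auto)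
        then show "deriv u field_differentiable at t \<and>
            deriv (deriv u) t + 2 * \<delta> t * deriv u t + lam\<^sup>2 * u t = 0"
          using DERIV_imp_deriv field_differentiable_def by fastforce
      qed
    qed
  qed
  moreover have "deriv u c = y0"
    using wp[OF \<open>c > 0\<close>] uw(2) pq(2)[of c] by simp
  moreover have "((\<lambda>t. p t * deriv u t) has_real_derivative - (lam\<^sup>2 * p t * u t)) (at t)" if "t > 0" for t
  proof (rule has_field_derivative_transform_within_open[of w _ _ "{0<..}"])
    show "(w has_real_derivative - (lam\<^sup>2 * p t * u t)) (at t)" using w[OF that] by simp
  qed (use that wp in auto)
  ultimately show thesis using that uw(1) pq(2) by blast
qed

text \<open>As long as \<open>u \<ge> 0\<close> we have \<open>u' \<le> 0\<close>, and then \<open>\<delta> \<ge> lam\<close> makes \<open>exp (lam t) u\<close> convex; so it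
  lies above its tangent at \<open>c\<close>, which forbids a first zero of \<open>u\<close>.\<close>

lemma overdamped_solution_lower_bound:
  assumes sol: "is_solution lam \<delta> u" and "lam > 0" "c > 0" and ge: "\<And>t. t \<ge> c \<Longrightarrow> \<delta> t \<ge> lam"
    and "u c > 0" "deriv u c = 0" and p: "\<And>t. p t > 0"
    and pder: "\<And>t. t > 0 \<Longrightarrow> ((\<lambda>t. p t * deriv u t) has_real_derivative - (lam\<^sup>2 * p t * u t)) (at t)"
    and "t \<ge> c"
  shows "exp (lam * c) * u c * (1 + lam * (t - c)) \<le> exp (lam * t) * u t"
proof -
  note u = is_solutionD(1)[OF sol]
  have tangent: "exp (lam * c) * u c * (1 + lam * (s - c)) \<le> exp (lam * s) * u s"
    if "c \<le> s" and nonneg: "\<And>r. r \<in> {c..s} \<Longrightarrow> u r \<ge> 0" for s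
  proof -
    \<comment> \<open>\<open>p * u'\<close> starts at 0 and has derivative
      \<open>-lam\<^sup>2 * p * u\<close>, which is nonpositive where \<open>u \<ge> 0\<close>;
      dividing by \<open>p > 0\<close> keeps the sign.\<close>
    have u'_le: "deriv u r \<le> 0" if r: "r \<in> {c..s}" for r
    proof -
      have "p r * deriv u r \<le> p c * deriv u c"
      proof (rule DERIV_nonpos_imp_nonincreasing[of c r "\<lambda>t. p t * deriv u t"])
        fix x assume x: "c \<le> x" "x \<le> r"
        then have "lam\<^sup>2 * p x * u x \<ge> 0"
          using p[of x] nonneg[of x] r by (intro mult_nonneg_nonneg) (auto simp: less_imp_le)
        then show "\<exists>y. ((\<lambda>t. p t * deriv u t) has_real_derivative y) (at x) \<and> y \<le> 0"
          using pder[of x] x \<open>c > 0\<close> by (intro exI[of _ "- (lam\<^sup>2 * p x * u x)"]) auto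
      qed (use r in auto)
      then show ?thesis
        using \<open>deriv u c = 0\<close> p[of r] by (simp add: mult_le_0_iff)
    qed
    \<comment> \<open>This is the derivative of \<open>exp (lam * t) * u t\<close>. It contains
      \<open>u'\<close>, so its monotonicity is obtained by integrating an almost everywhere
      derivative.\<close>
    define y where "y t = exp (lam * t) * (deriv u t + lam * u t)" for t
    have y_ge: "y c \<le> y r" if r: "r \<in> {c..s}" for r
    proof -
      have v: "abs_continuous_on {c..r} (deriv u)" using is_solutionD(3)[OF sol \<open>c > 0\<close>] .
      have vcont: "continuous_on {c..r} (deriv u)" by (rule abs_continuous_on_imp_continuous_on[OF v])
      have "abs_continuous_on {c..r} (\<lambda>t. lam * u t)"
      proof (rule abs_continuous_on_continuous_deriv)
        show "((\<lambda>t. lam * u t) has_real_derivative lam * deriv u x) (at x)" if "x \<in> {c..r}" for x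
          using u[of x] that \<open>c > 0\<close> by (intro DERIV_cmult) auto
      qed (intro continuous_intros vcont)
      with v have sum: "abs_continuous_on {c..r} (\<lambda>t. deriv u t + lam * u t)"
        by (rule abs_continuous_on_add)
      have exp: "abs_continuous_on {c..r} (\<lambda>t. exp (lam * t))"
        by (rule abs_continuous_on_continuous_deriv[of _ _ _ "\<lambda>t. lam * exp (lam * t)"])
           (auto intro!: derivative_eq_intros continuous_intros)
      obtain B1 where B1: "\<And>t. t \<in> {c..r} \<Longrightarrow> \<bar>deriv u t + lam * u t\<bar> \<le> B1"
        using continuous_on_interval_bounded[OF abs_continuous_on_imp_continuous_on[OF sum]] by blast
      obtain B2 where B2: "\<And>t. t \<in> {c..r} \<Longrightarrow> \<bar>exp (lam * t)\<bar> \<le> B2"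
        using continuous_on_interval_bounded[OF abs_continuous_on_imp_continuous_on[OF exp]] by blast
      have "abs_continuous_on {c..r} y"
        unfolding y_def[abs_def] using exp B2 sum B1 by (rule abs_continuous_on_mult)
      then have "integral {c..r} (\<lambda>_. 0) \<le> y r - y c"
      proof (rule abs_continuous_diff_ge_integral[rotated])
        show "AE t in lebesgue. t \<in> {c..r} \<longrightarrow>
            (y has_real_derivative exp (lam * t) * (2 * ((lam - \<delta> t) * deriv u t))) (at t) \<and>
            0 \<le> exp (lam * t) * (2 * ((lam - \<delta> t) * deriv u t))"
          using is_solutionD(4)[OF sol]
        proof eventually_elim
          case (elim t)
          show ?case
          proof (intro impI conjI)
            assume t: "t \<in> {c..r}"
            then have "t > 0" using \<open>c > 0\<close> by auto
            with elim have v: "(deriv u has_real_derivative - (2 * \<delta> t * deriv u t + lam\<^sup>2 * u t)) (at t)"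
              by blast
            show "(y has_real_derivative exp (lam * t) * (2 * ((lam - \<delta> t) * deriv u t))) (at t)"
              unfolding y_def[abs_def]
              by (rule derivative_eq_intros v u[OF \<open>t > 0\<close>] refl)+
                 (simp add: algebra_simps power2_eq_square)
            have "lam - \<delta> t \<le> 0" "deriv u t \<le> 0" using ge[of t] u'_le[of t] t r by auto
            then show "0 \<le> exp (lam * t) * (2 * ((lam - \<delta> t) * deriv u t))"
              by (simp add: mult_nonpos_nonpos)
          qed
        qed
      qed (use r in auto)
      then show ?thesis by simp
    qed
    \<comment> \<open>Subtracting the line of slope \<open>y c\<close> reduces the tangent
      inequality to monotonicity of \<open>H\<close>.\<close>
    define H where "H t = exp (lam * t) * u t - y c * t" for t
    have "H c \<le> H s"
    proof (rule DERIV_nonneg_imp_nondecreasing[OF \<open>c \<le> s\<close>])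
      fix x assume x: "c \<le> x" "x \<le> s"
      then have "x > 0" using \<open>c > 0\<close> by simp
      have "(H has_real_derivative y x - y c) (at x)"
        unfolding H_def[abs_def]
        by (rule derivative_eq_intros u[OF \<open>x > 0\<close>] refl)+ (simp add: y_def algebra_simps)
      moreover have "y x - y c \<ge> 0" using y_ge[of x] x by simp
      ultimately show "\<exists>y. (H has_real_derivative y) (at x) \<and> 0 \<le> y" by blast
    qed
    moreover have "y c = exp (lam * c) * lam * u c"
      using \<open>deriv u c = 0\<close> by (simp add: y_def)
    ultimately show ?thesis by (simp add: H_def algebra_simps)
  qed
  have cont: "continuous_on {c..r} u" for r
    using \<open>c > 0\<close> by (intro continuous_at_imp_continuous_on ballI DERIV_isCont[OF u]) auto
  have pos: "u r > 0" if "c \<le> r" for r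
  proof (rule ccontr)
    define S where "S = {x \<in> {c..r}. u x = 0}"
    assume "\<not> u r > 0"
    then have "\<exists>x\<ge>c. x \<le> r \<and> u x = 0"
      using \<open>u c > 0\<close> cont[of r] \<open>c \<le> r\<close> by (intro IVT2') auto
    then have "S \<noteq> {}" by (auto simp: S_def)
    moreover have "closed S"
      unfolding S_def by (intro continuous_closed_preimage_constant cont) auto
    moreover have "bdd_below S" by (rule bdd_belowI[of _ c]) (auto simp: S_def)
    ultimately have "Inf S \<in> S" by (intro closed_contains_Inf)
    then have s: "c \<le> Inf S" "Inf S \<le> r" "u (Inf S) = 0" by (auto simp: S_def)
    \<comment> \<open>A negative value at or before the first zero would force, by the intermediate
      value theorem, a zero strictly before it.\<close>
    have "u x \<ge> 0" if x: "x \<in> {c..Inf S}" for x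
    proof (rule ccontr)
      assume neg: "\<not> u x \<ge> 0"
      then have "\<exists>z\<ge>c. z \<le> x \<and> u z = 0"
        using \<open>u c > 0\<close> cont[of x] x by (intro IVT2') auto
      then obtain z where z: "c \<le> z" "z \<le> x" "u z = 0" by blast
      then have "z \<in> S" using x s by (auto simp: S_def)
      then have "Inf S \<le> z" using \<open>bdd_below S\<close> by (rule cInf_lower)
      then have "z = x" using x z by auto
      with z neg show False by simp
    qed
    \<comment> \<open>At the first zero the tangent bound would place a positive number below
      0.\<close>
    from tangent[OF s(1) this] have "exp (lam * c) * u c * (1 + lam * (Inf S - c)) \<le> 0"
      using s by simp
    moreover have "exp (lam * c) * u c * (1 + lam * (Inf S - c)) > 0"
      using \<open>u c > 0\<close> \<open>lam > 0\<close> s by (intro mult_pos_pos add_pos_nonneg) auto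
    ultimately show False by simp
  qed
  show ?thesis
    using tangent[OF \<open>t \<ge> c\<close>] pos by (auto simp: less_imp_le)
qed

theorem proposition2p7:
  fixes lam :: real and \<delta> :: "real \<Rightarrow> real"
  assumes "lam > 0"
    and "\<delta> loc_integrable_on {0<..}"
    and "\<forall>t>0. \<delta> t \<ge> 0"
  shows
    "(\<delta> absolutely_integrable_on {0<..} \<longrightarrow>
        (\<forall>u. is_solution lam \<delta> u \<and> (\<exists>t>0. u t \<noteq> 0) \<longrightarrow>
           \<not> ((\<lambda>t. \<bar>deriv u t\<bar>\<^sup>2 + lam\<^sup>2 * \<bar>u t\<bar>\<^sup>2) \<longlongrightarrow> 0) at_top))
     \<and>
     (\<forall>M>0. (\<forall>t>0. \<delta> t \<le> M) \<longrightarrow>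
        (\<forall>u. is_solution lam \<delta> u \<longrightarrow>
           continuous_on {0..} (ext0 u) \<and> continuous_on {0..} (ext0 (deriv u)) \<and>
           (\<forall>t\<ge>0. \<bar>ext0 (deriv u) t\<bar>\<^sup>2 + lam\<^sup>2 * \<bar>ext0 u t\<bar>\<^sup>2
              \<ge> (\<bar>ext0 (deriv u) 0\<bar>\<^sup>2 + lam\<^sup>2 * \<bar>ext0 u 0\<bar>\<^sup>2) * exp (- 4 * M * t))))
     \<and>
     (\<forall>T\<ge>0. (\<forall>t>0. t \<ge> T \<longrightarrow> \<delta> t \<ge> lam) \<longrightarrow>
        (\<exists>Tstar\<ge>T. \<exists>u. is_solution lam \<delta> u \<and>
           (\<forall>t\<ge>Tstar. \<bar>u t\<bar> \<ge> t * exp (- lam * t))))"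
proof (intro conjI)
  show "\<delta> absolutely_integrable_on {0<..} \<longrightarrow>
        (\<forall>u. is_solution lam \<delta> u \<and> (\<exists>t>0. u t \<noteq> 0) \<longrightarrow>
           \<not> ((\<lambda>t. \<bar>deriv u t\<bar>\<^sup>2 + lam\<^sup>2 * \<bar>u t\<bar>\<^sup>2) \<longlongrightarrow> 0) at_top)"
  proof (intro impI allI, elim conjE exE)
    fix u t0 assume int: "\<delta> absolutely_integrable_on {0<..}" and sol: "is_solution lam \<delta> u"
      and t0: "0 < t0" "u t0 \<noteq> 0"
    have "\<delta> integrable_on {0<..}"
      using int set_lebesgue_integral_eq_integral(1) by blast
    then have "\<not> (energy lam u \<longlongrightarrow> 0) at_top"
      using assms t0 by (intro energy_not_tendsto_0[OF sol]) auto
    then show "\<not> ((\<lambda>t. \<bar>deriv u t\<bar>\<^sup>2 + lam\<^sup>2 * \<bar>u t\<bar>\<^sup>2) \<longlongrightarrow> 0) at_top"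
      by (simp add: energy_def[abs_def])
  qed
  show "\<forall>M>0. (\<forall>t>0. \<delta> t \<le> M) \<longrightarrow>
        (\<forall>u. is_solution lam \<delta> u \<longrightarrow>
           continuous_on {0..} (ext0 u) \<and> continuous_on {0..} (ext0 (deriv u)) \<and>
           (\<forall>t\<ge>0. \<bar>ext0 (deriv u) t\<bar>\<^sup>2 + lam\<^sup>2 * \<bar>ext0 u t\<bar>\<^sup>2
              \<ge> (\<bar>ext0 (deriv u) 0\<bar>\<^sup>2 + lam\<^sup>2 * \<bar>ext0 u 0\<bar>\<^sup>2) * exp (- 4 * M * t)))"
  proof (intro allI impI)
    fix M u assume M: "\<forall>t>0. \<delta> t \<le> M" and sol: "is_solution lam \<delta> u"
    obtain l l' where l: "(u \<longlongrightarrow> l) (at_right 0)" "(deriv u \<longlongrightarrow> l') (at_right 0)"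
      and le: "\<And>t. t > 0 \<Longrightarrow> (l'\<^sup>2 + lam\<^sup>2 * l\<^sup>2) * exp (- 4 * M * t) \<le> energy lam u t"
      using solution_limits_at_0[OF sol assms(1,2), of M] assms(3) M by blast
    have "continuous_on {0<..} u"
      using is_solutionD(1)[OF sol] by (auto intro!: continuous_at_imp_continuous_on intro: DERIV_isCont)
    note u = ext0_continuous_on[OF this l(1)]
    note v = ext0_continuous_on[OF is_solutionD(2)[OF sol] l(2)]
    have "(\<bar>ext0 (deriv u) 0\<bar>\<^sup>2 + lam\<^sup>2 * \<bar>ext0 u 0\<bar>\<^sup>2) * exp (- 4 * M * t)
        \<le> \<bar>ext0 (deriv u) t\<bar>\<^sup>2 + lam\<^sup>2 * \<bar>ext0 u t\<bar>\<^sup>2" if "t \<ge> 0" for t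
    \<comment> \<open>At 0 the exponential is 1 and both sides agree; for positive \<open>t\<close>
      the extension is the function itself.\<close>
    proof (cases "t = 0")
      case False
      then have "ext0 u t = u t" "ext0 (deriv u) t = deriv u t" by (simp_all add: ext0_def)
      then show ?thesis
        using le[of t] that False by (simp add: u(1) v(1) energy_def)
    qed simp
    then show "continuous_on {0..} (ext0 u) \<and> continuous_on {0..} (ext0 (deriv u)) \<and>
           (\<forall>t\<ge>0. \<bar>ext0 (deriv u) t\<bar>\<^sup>2 + lam\<^sup>2 * \<bar>ext0 u t\<bar>\<^sup>2
              \<ge> (\<bar>ext0 (deriv u) 0\<bar>\<^sup>2 + lam\<^sup>2 * \<bar>ext0 u 0\<bar>\<^sup>2) * exp (- 4 * M * t))"
      using u(2) v(2) by blast
  qed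
  show "\<forall>T\<ge>0. (\<forall>t>0. t \<ge> T \<longrightarrow> \<delta> t \<ge> lam) \<longrightarrow>
        (\<exists>Tstar\<ge>T. \<exists>u. is_solution lam \<delta> u \<and>
           (\<forall>t\<ge>Tstar. \<bar>u t\<bar> \<ge> t * exp (- lam * t)))"
  proof (intro allI impI)
    fix T :: real assume T: "\<forall>t>0. t \<ge> T \<longrightarrow> \<delta> t \<ge> lam"
    \<comment> \<open>The maximum with 1 keeps the initial point positive when
      \<open>T = 0\<close>.\<close>
    define c where "c = max T 1"
    \<comment> \<open>Chosen so that \<open>x0 * (1 + lam * (t - c))\<close> is \<open>t\<close>
      plus terms that are nonnegative for \<open>t \<ge> c\<close>.\<close>
    define x0 where "x0 = c + 1 / lam"
    have c: "c > 0" "T \<le> c" by (auto simp: c_def)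
    have "x0 > 0" using c \<open>lam > 0\<close> by (simp add: x0_def add_pos_pos)
    obtain u p where sol: "is_solution lam \<delta> u" and u: "u c = x0" "deriv u c = 0" and p: "\<And>t. p t > 0"
      "\<And>t. t > 0 \<Longrightarrow> ((\<lambda>t. p t * deriv u t) has_real_derivative - (lam\<^sup>2 * p t * u t)) (at t)"
      using solution_exists[OF assms(2) \<open>c > 0\<close>, of lam x0 0] by blast
    have "t * exp (- lam * t) \<le> \<bar>u t\<bar>" if "t \<ge> c" for t
    proof -
      have "x0 * (1 + lam * (t - c)) = t + (c * lam * (t - c) + 1 / lam)"
        using \<open>lam > 0\<close> by (simp add: x0_def field_simps)
      moreover have "c * lam * (t - c) + 1 / lam \<ge> 0"
        using \<open>lam > 0\<close> c that by (intro add_nonneg_nonneg mult_nonneg_nonneg) auto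
      ultimately have "t \<le> 1 * (x0 * (1 + lam * (t - c)))"
        by linarith
      \<comment> \<open>The surplus factor \<open>exp (lam * c)\<close> in the tangent bound is at
        least 1, since \<open>lam\<close> and \<open>c\<close> are positive.\<close>
      also have "\<dots> \<le> exp (lam * c) * (x0 * (1 + lam * (t - c)))"
        using \<open>lam > 0\<close> c that \<open>x0 > 0\<close> by (intro mult_right_mono mult_nonneg_nonneg) auto
      also have "\<dots> \<le> exp (lam * t) * u t"
        using overdamped_solution_lower_bound[OF sol \<open>lam > 0\<close> \<open>c > 0\<close> _ _ u(2) p that] T c u(1) \<open>x0 > 0\<close>
        by (simp add: mult.assoc)
      finally have "t * exp (- lam * t) \<le> exp (lam * t) * u t * exp (- lam * t)"
        by (intro mult_right_mono) auto
      also have "\<dots> = u t" by (simp add: exp_minus)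
      finally show ?thesis by linarith
    qed
    then show "\<exists>Tstar\<ge>T. \<exists>u. is_solution lam \<delta> u \<and> (\<forall>t\<ge>Tstar. \<bar>u t\<bar> \<ge> t * exp (- lam * t))"
      using sol c by blast
  qed
qed

end
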